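(* Let $G$ be a claw-free graph of diameter $2$ that has distinct neighbourhoods, admits no W-join, satisfies $\alpha(G)>3$, and has $|V(G)|>13$. Then $G$ is a proper circular-arc graph or a line graph.
   Context: Graphs are finite, simple, undirected. $N(u)$ is the neighbourhood of $u$. Two adjacent vertices $u,v$ have nested neighbourhoods if $N(u)\setminus\{v\}\subseteq N(v)\setminus\{u\}$ or $N(v)\setminus\{u\}\subseteq N(u)\setminus\{v\}$; $G$ has distinct neighbourhoods if no two vertices of $G$ have nested neighbourhoods. Two disjoint vertex sets $S,T$ are complete if every vertex of $S$ is adjacent to every vertex of $T$, and anticomplete if there is no edge between $S$ and $T$. A pair $(A,B)$ of disjoint non-empty vertex sets is a W-join if $|A|+|B|>2$, $A$ and $B$ are cliques, $A$ is neither complete nor anticomplete to $B$, and every vertex of $V(G)\setminus(A\cup B)$ is either complete or anticomplete to $A$ and either complete or anticomplete to $B$. $\alpha(G)$ is the independence number. A graph is claw-free if it has no induced $K_{1,3}$. A circular-arc graph is proper if it has an arc representation in which no arc is contained in another. The line graph $L(H)$ of $H$ has the edges of $H$ as vertices, two adjacent iff they share an endpoint. *)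

theory Defs
  imports Complex_Main "Graph_Theory.Graph_Theory"
begin

text \<open>
  Finite simple undirected graphs are the library's \<open>pair_graph\<close>s: finite, loop-free, and with a
  symmetric arc set, so that the edge \<open>uv\<close> is represented by the two arcs \<open>(u,v)\<close> and \<open>(v,u)\<close>.
\<close>

abbreviation adj :: "'a pair_pre_digraph \<Rightarrow> 'a \<Rightarrow> 'a \<Rightarrow> bool" where
  "adj G u v \<equiv> (u, v) \<in> parcs G"

definition nbhd :: "'a pair_pre_digraph \<Rightarrow> 'a \<Rightarrow> 'a set" where
  "nbhd G u = {v. adj G u v}"

definition nested_nbhds :: "'a pair_pre_digraph \<Rightarrow> 'a \<Rightarrow> 'a \<Rightarrow> bool" where
  "nested_nbhds G u v \<longleftrightarrow> adj G u v \<and>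
     (nbhd G u - {v} \<subseteq> nbhd G v - {u} \<or> nbhd G v - {u} \<subseteq> nbhd G u - {v})"

definition distinct_nbhds :: "'a pair_pre_digraph \<Rightarrow> bool" where
  "distinct_nbhds G \<longleftrightarrow> \<not> (\<exists>u\<in>pverts G. \<exists>v\<in>pverts G. nested_nbhds G u v)"

definition complete_to :: "'a pair_pre_digraph \<Rightarrow> 'a set \<Rightarrow> 'a set \<Rightarrow> bool" where
  "complete_to G S T \<longleftrightarrow> (\<forall>s\<in>S. \<forall>t\<in>T. adj G s t)"

definition anticomplete_to :: "'a pair_pre_digraph \<Rightarrow> 'a set \<Rightarrow> 'a set \<Rightarrow> bool" where
  "anticomplete_to G S T \<longleftrightarrow> (\<forall>s\<in>S. \<forall>t\<in>T. \<not> adj G s t)"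

definition clique :: "'a pair_pre_digraph \<Rightarrow> 'a set \<Rightarrow> bool" where
  "clique G S \<longleftrightarrow> S \<subseteq> pverts G \<and> (\<forall>u\<in>S. \<forall>v\<in>S. u \<noteq> v \<longrightarrow> adj G u v)"

definition W_join :: "'a pair_pre_digraph \<Rightarrow> 'a set \<Rightarrow> 'a set \<Rightarrow> bool" where
  "W_join G A B \<longleftrightarrow>
     A \<subseteq> pverts G \<and> B \<subseteq> pverts G \<and> A \<inter> B = {} \<and> A \<noteq> {} \<and> B \<noteq> {} \<and>
     card A + card B > 2 \<and> clique G A \<and> clique G B \<and>
     \<not> complete_to G A B \<and> \<not> anticomplete_to G A B \<and>
     (\<forall>v \<in> pverts G - (A \<union> B).
        (complete_to G {v} A \<or> anticomplete_to G {v} A) \<and>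
        (complete_to G {v} B \<or> anticomplete_to G {v} B))"

definition independent_set :: "'a pair_pre_digraph \<Rightarrow> 'a set \<Rightarrow> bool" where
  "independent_set G S \<longleftrightarrow> S \<subseteq> pverts G \<and> (\<forall>u\<in>S. \<forall>v\<in>S. \<not> adj G u v)"

definition independence_number :: "'a pair_pre_digraph \<Rightarrow> nat" where
  "independence_number G = Max {card S | S. independent_set G S}"

definition claw_free :: "'a pair_pre_digraph \<Rightarrow> bool" where
  "claw_free G \<longleftrightarrow> \<not> (\<exists>C. induced_subgraph C (with_proj G) \<and> K\<^bsub>1,3\<^esub> C)"

text \<open>
  With unit arc costs, \<open>\<mu>\<close> is the usual graph distance (\<open>\<infinity>\<close> if there is no walk).
\<close>

definition graph_diameter :: "'a pair_pre_digraph \<Rightarrow> ereal" where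
  "graph_diameter G =
     (SUP u\<in>pverts G. SUP v\<in>pverts G. wf_digraph.\<mu> (with_proj G) (\<lambda>_. 1) u v)"

text \<open>
  Arcs are closed, non-degenerate and different from the whole circle; in a proper representation
  distinct vertices also have distinct arcs.  None of these conventions affects which finite graphs
  are proper circular-arc graphs, since finitely many arcs can be perturbed.
\<close>

definition circle_arc :: "complex set \<Rightarrow> bool" where
  "circle_arc X \<longleftrightarrow> (\<exists>a b. a < b \<and> b < a + 2 * pi \<and> X = cis ` {a..b})"

definition circular_arc_rep :: "'a pair_pre_digraph \<Rightarrow> ('a \<Rightarrow> complex set) \<Rightarrow> bool" where
  "circular_arc_rep G I \<longleftrightarrow>
     (\<forall>v\<in>pverts G. circle_arc (I v)) \<and>
     (\<forall>u\<in>pverts G. \<forall>v\<in>pverts G. u \<noteq> v \<longrightarrow> (adj G u v \<longleftrightarrow> I u \<inter> I v \<noteq> {}))"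

definition proper_circular_arc_graph :: "'a pair_pre_digraph \<Rightarrow> bool" where
  "proper_circular_arc_graph G \<longleftrightarrow>
     (\<exists>I. circular_arc_rep G I \<and>
       (\<forall>u\<in>pverts G. \<forall>v\<in>pverts G. u \<noteq> v \<longrightarrow> \<not> I u \<subseteq> I v))"

definition edges :: "'a pair_pre_digraph \<Rightarrow> 'a set set" where
  "edges H = {{u, v} | u v. adj H u v}"

definition line_graph :: "'a pair_pre_digraph \<Rightarrow> 'a set pair_pre_digraph" where
  "line_graph H =
     \<lparr> pverts = edges H,
       parcs = {(e, f). e \<in> edges H \<and> f \<in> edges H \<and> e \<noteq> f \<and> e \<inter> f \<noteq> {}} \<rparr>"

text \<open>
  Every finite graph is isomorphic to one whose vertices are natural numbers, so restricting the
  vertex type of the root graph \<open>H\<close> below loses no generality.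
\<close>

definition is_line_graph :: "'a pair_pre_digraph \<Rightarrow> bool" where
  "is_line_graph G \<longleftrightarrow>
     (\<exists>H :: nat pair_pre_digraph.
        pair_graph H \<and> digraph_iso (with_proj G) (with_proj (line_graph H)))"

end

theory Submission
  imports Defs
begin

text \<open>
  The graph is always a line graph. Fix a maximum independent set \<open>S\<close>; if \<open>G\<close> is a line graph,
  \<open>S\<close> is a maximum matching of the root graph. Every other vertex sees one or two vertices of \<open>S\<close>,
  and any two vertices of \<open>S\<close> have a common neighbour because the diameter is 2. Inside the
  neighbourhood of \<open>s \<in> S\<close>, claw-freeness makes adjacency between the classes of vertices also adjacent
  to \<open>t\<close> (\<open>t \<in> S - {s}\<close>) a balanced signed multipartite graph, and as \<open>|S| \<ge> 4\<close> gives at least three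
  classes, these vertices split into two cliques, one for each end of the edge \<open>s\<close>. The vertices
  seeing only one element of \<open>S\<close> form further cliques, which correspond to the unmatched
  vertices of the root graph. Each vertex is thus assigned two ends, and two vertices sharing an
  end are adjacent. An adjacent pair without a common end confines part of the graph to
  two of these cliques, and the vertices with no neighbours outside the two cliques then form a
  W-join; one exceptional configuration with \<open>|S| = 4\<close> contradicts the diameter and the distinct
  neighbourhoods. Finally, two vertices with the same ends would have nested neighbourhoods.
\<close>

text \<open>The edge and the non-edge between \<open>A\<close> and \<open>B\<close> in
  \<open>no_W_join\<close> say that the pair is neither complete nor anticomplete, and they force
  more than two vertices.\<close>

locale claw_free_diam2 =
  fixes V :: "'a set" and E :: "'a \<Rightarrow> 'a \<Rightarrow> bool" and S :: "'a set"
  assumes finite_V: "finite V"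
    and E_sym: "E u v \<Longrightarrow> E v u"
    and E_irrefl: "\<not> E v v"
    and E_V: "E u v \<Longrightarrow> u \<in> V"
    and no_claw: "\<lbrakk>E c x; E c y; E c z; \<not> E x y; \<not> E x z; \<not> E y z; x \<noteq> y; x \<noteq> z; y \<noteq> z\<rbrakk> \<Longrightarrow> False"
    and diam: "\<lbrakk>u \<in> V; v \<in> V; u \<noteq> v; \<not> E u v\<rbrakk> \<Longrightarrow> \<exists>w. E u w \<and> E w v"
    and not_nested: "E u v \<Longrightarrow> \<exists>w. E u w \<and> w \<noteq> v \<and> \<not> E v w"
    and no_W_join: "\<lbrakk>A \<inter> B = {};
        \<And>a a'. \<lbrakk>a \<in> A; a' \<in> A; a \<noteq> a'\<rbrakk> \<Longrightarrow> E a a'; \<And>b b'. \<lbrakk>b \<in> B; b' \<in> B; b \<noteq> b'\<rbrakk> \<Longrightarrow> E b b';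
        \<And>v. \<lbrakk>v \<in> V; v \<notin> A; v \<notin> B\<rbrakk> \<Longrightarrow> (\<forall>a\<in>A. E v a) \<or> (\<forall>a\<in>A. \<not> E v a);
        \<And>v. \<lbrakk>v \<in> V; v \<notin> A; v \<notin> B\<rbrakk> \<Longrightarrow> (\<forall>b\<in>B. E v b) \<or> (\<forall>b\<in>B. \<not> E v b);
        A \<subseteq> V; B \<subseteq> V; a \<in> A; b \<in> B; E a b; a' \<in> A; b' \<in> B; \<not> E a' b'\<rbrakk> \<Longrightarrow> False"
    and S_V: "S \<subseteq> V"
    and S_indep: "\<lbrakk>u \<in> S; v \<in> S\<rbrakk> \<Longrightarrow> \<not> E u v"
    and S_max: "\<lbrakk>T \<subseteq> V; \<And>u v. \<lbrakk>u \<in> T; v \<in> T\<rbrakk> \<Longrightarrow> \<not> E u v\<rbrakk> \<Longrightarrow> card T \<le> card S"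
    and S_card: "card S \<ge> 4"
begin

section \<open>Neighbours in \<open>S\<close> and the first forbidden claws\<close>

lemma finite_S: "finite S"
  using S_V finite_V finite_subset by blast

text \<open>
  \<open>tw s t\<close> and \<open>si s\<close> hold for the vertices outside \<open>S\<close> whose neighbours in \<open>S\<close> are exactly
  \<open>s, t\<close>, respectively exactly \<open>s\<close>; for \<open>tw\<close> exactness comes from claw-freeness.
\<close>
definition tw :: "'a \<Rightarrow> 'a \<Rightarrow> 'a \<Rightarrow> bool" where
  "tw s t x \<longleftrightarrow> s \<in> S \<and> t \<in> S \<and> s \<noteq> t \<and> E x s \<and> E x t"

definition si :: "'a \<Rightarrow> 'a \<Rightarrow> bool" where
  "si s c \<longleftrightarrow> s \<in> S \<and> E c s \<and> (\<forall>t\<in>S. E c t \<longrightarrow> t = s)"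

lemma tw_sym: "tw s t x \<Longrightarrow> tw t s x"
  by (auto simp: tw_def)

lemma twD:
  assumes "tw s t x"
  shows "s \<in> S" "t \<in> S" "s \<noteq> t" "E x s" "E x t" "E s x" "E t x" "x \<in> V" "x \<notin> S"
  using assms E_sym E_V S_indep unfolding tw_def by blast+

lemma siD:
  assumes "si s c"
  shows "s \<in> S" "E c s" "E s c" "c \<in> V" "c \<notin> S"
  using assms E_sym E_V S_indep unfolding si_def by blast+

text \<open>A third neighbour in the independent set \<open>S\<close> would give a claw at
  \<open>x\<close>.\<close>

lemma tw_only: "\<lbrakk>tw s t x; u \<in> S; E x u\<rbrakk> \<Longrightarrow> u = s \<or> u = t"
  using no_claw[of x s t u] S_indep unfolding tw_def by blast

lemma si_only: "\<lbrakk>si s c; u \<in> S; E c u\<rbrakk> \<Longrightarrow> u = s"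
  unfolding si_def by blast

lemma tw_not_si: "tw s t x \<Longrightarrow> \<not> si u x"
  using twD(1-5) si_only by metis

lemma tw_unique: "\<lbrakk>tw s t x; tw s u x\<rbrakk> \<Longrightarrow> t = u"
  using tw_only[of s t x u] unfolding tw_def by blast

text \<open>Otherwise \<open>x\<close> is the centre of a claw with leaves \<open>s\<close>,
  \<open>t\<close>, \<open>y\<close>.\<close>

lemma tw_disjoint_nonadj: "\<lbrakk>tw s t x; tw u v y; s \<noteq> u; s \<noteq> v; t \<noteq> u; t \<noteq> v\<rbrakk> \<Longrightarrow> \<not> E x y"
proof
  assume a: "tw s t x" "tw u v y" "s \<noteq> u" "s \<noteq> v" "t \<noteq> u" "t \<noteq> v" "E x y"
  have "\<not> E y s" "\<not> E y t"
    using a tw_only by (metis tw_def)+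
  then show False
    using no_claw[of x s t y] a S_indep twD E_sym E_irrefl by metis
qed

lemma si_tw_nonadj: "\<lbrakk>si s c; tw t u x; s \<noteq> t; s \<noteq> u\<rbrakk> \<Longrightarrow> \<not> E c x \<and> \<not> E x c"
proof -
  assume a: "si s c" "tw t u x" "s \<noteq> t" "s \<noteq> u"
  have "\<not> E c t" "\<not> E c u"
    using a si_only twD(1,2) by blast+
  then have "\<not> E x c"
    using no_claw[of x t u c] S_indep[of t u] twD[OF a(2)] siD(5)[OF a(1)] E_sym by blast
  then show ?thesis using E_sym by blast
qed

text \<open>If not, exchanging \<open>s\<close> for \<open>c\<close> and \<open>c'\<close> would
  enlarge \<open>S\<close>.\<close>

lemma si_clique:
  assumes "si s c" "si s c'" "c \<noteq> c'"
  shows "E c c'"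
proof (rule ccontr)
  assume n: "\<not> E c c'"
  let ?T = "insert c (insert c' (S - {s}))"
  have i: "\<not> E u v" if "u \<in> ?T" "v \<in> ?T" for u v
    using that n assms si_only E_sym E_irrefl S_indep by (auto; blast)
  have "?T \<subseteq> V" using assms siD S_V by auto
  then have "card ?T \<le> card S" using S_max i by blast
  moreover have "card ?T = Suc (card S)"
    using assms siD(1,5) finite_S card_Suc_Diff1[of S s] by (simp add: card_insert_if)
  ultimately show False by simp
qed

lemma outside_cases:
  assumes "v \<in> V" "v \<notin> S"
  obtains s where "si s v" | s t where "tw s t v"
proof -
  have "\<exists>s\<in>S. E v s"
  proof (rule ccontr)
    assume n: "\<not> ?thesis"
    have "card (insert v S) \<le> card S"
      using n assms S_V S_indep E_sym E_irrefl by (intro S_max) auto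
    then show False using assms finite_S by simp
  qed
  then show ?thesis using that unfolding si_def tw_def by metis
qed

lemma tw_exists: "\<lbrakk>s \<in> S; t \<in> S; s \<noteq> t\<rbrakk> \<Longrightarrow> \<exists>x. tw s t x"
  using diam[of s t] S_V S_indep E_sym unfolding tw_def by blast

lemma S_avoid:
  assumes "finite X" "card X \<le> 3"
  shows "\<exists>u\<in>S. u \<notin> X"
proof (rule ccontr)
  assume "\<not> ?thesis"
  then have "S \<subseteq> X" by blast
  then have "card S \<le> card X" using assms card_mono by blast
  then show False using assms S_card by simp
qed

lemma S_avoid3: "\<exists>u\<in>S. u \<noteq> a \<and> u \<noteq> b \<and> u \<noteq> c"
  using S_avoid[of "{a, b, c}"] card_length[of "[a,b,c]"] by simp

text \<open>If only one of \<open>x\<close>, \<open>y\<close> saw \<open>c\<close>, it would be the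
  centre of a claw whose leaves are \<open>c\<close>, the other one, and its own second neighbour in
  \<open>S\<close>.\<close>

lemma tw_si_triple:
  assumes "tw s t x" "tw s u y" "t \<noteq> u" "E x y" "si s c"
  shows "E c x = E c y"
proof -
  have "E c y'" if "tw s t' x'" "tw s u' y'" "t' \<noteq> u'" "E x' y'" "E c x'" for x' y' t' u'
  proof (rule ccontr)
    assume "\<not> E c y'"
    moreover have "\<not> E c t'" using that assms si_only twD by metis
    moreover have "\<not> E y' t'" using that tw_only twD by metis
    ultimately show False
      using no_claw[of x' c y' t'] that twD(5,2,9) siD(5) si_only assms(5) by (metis twD(3) E_sym)
  qed
  from this[of t x u y] this[of u y t x] show ?thesis using assms E_sym by blast
qed

lemma nonadj_si: "\<lbrakk>tw s t x; tw s u y; \<not> E x y; x \<noteq> y; si s c\<rbrakk> \<Longrightarrow> E c x \<or> E c y"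
  using no_claw[of s x y c] E_sym twD(6) siD(3) tw_not_si by metis

text \<open>The number of edges among the three vertices is odd: a claw at \<open>s\<close> excludes
  zero, and two edges without the third make a claw at their common vertex.\<close>

lemma tw_triple:
  assumes "tw s t x" "tw s u y" "tw s v z" "t \<noteq> u" "t \<noteq> v" "u \<noteq> v"
  shows "E x y \<longleftrightarrow> (E x z \<longleftrightarrow> E y z)"
proof -
  have two: "E b c" if "tw s t' a" "tw s u' b" "tw s v' c" "t' \<noteq> u'" "t' \<noteq> v'" "u' \<noteq> v'"
    "E a b" "E a c" for a b c t' u' v'
  proof (rule ccontr)
    assume "\<not> E b c"
    moreover have "\<not> E b t'" "\<not> E c t'" using that tw_only twD by metis+
    ultimately show False
      using no_claw[of a b c t'] that twD tw_unique by metis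
  qed
  have ne: "x \<noteq> y" "x \<noteq> z" "y \<noteq> z" using assms tw_unique by blast+
  have "E x y \<or> E x z \<or> E y z"
    using no_claw[of s x y z] assms twD ne by metis
  then show ?thesis
    using two[of t x u y v z] two[of u y t x v z] two[of v z t x u y] assms E_sym by metis
qed

section \<open>Two-colouring the neighbourhood of a vertex of \<open>S\<close>\<close>

text \<open>The two values stand for the two ends of the root edge \<open>s\<close>. Pairs inside
  one class are left open here; \<open>col_eq_adj\<close> and \<open>tw_opposite_nonadj\<close>
  settle them.\<close>

definition coloring :: "'a \<Rightarrow> ('a \<Rightarrow> bool) \<Rightarrow> bool" where
  "coloring s f \<longleftrightarrow> (\<forall>t u x y. tw s t x \<longrightarrow> tw s u y \<longrightarrow> t \<noteq> u \<longrightarrow> (E x y \<longleftrightarrow> f x = f y))"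

text \<open>
  Adjacency between the classes \<open>tw s t\<close> for fixed \<open>s\<close> is a complete multipartite signed graph
  whose triangles are balanced; with at least three parts such a graph is balanced.
\<close>
lemma coloring_exists:
  assumes "s \<in> S"
  shows "\<exists>f. coloring s f"
proof -
  obtain t0 where t0: "t0 \<in> S" "t0 \<noteq> s" using S_avoid3[of s s s] by blast
  obtain t1 where t1: "t1 \<in> S" "t1 \<noteq> s" "t1 \<noteq> t0" using S_avoid3[of s t0 t0] by blast
  obtain t2 where t2: "t2 \<in> S" "t2 \<noteq> s" "t2 \<noteq> t0" "t2 \<noteq> t1" using S_avoid3[of s t0 t1] by blast
  obtain x0 x1 x2 where x: "tw s t0 x0" "tw s t1 x1" "tw s t2 x2"
    using tw_exists assms t0 t1 t2 by metis
  \<comment> \<open>The colour is read off from adjacency to \<open>x0\<close>; inside the class of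
    \<open>x0\<close>, from whether a vertex treats \<open>x1\<close> as \<open>x0\<close>
    does.\<close>
  define f where "f x = (if tw s t0 x then E x x1 = E x0 x1 else E x x0)" for x
  have main: "E x y \<longleftrightarrow> f x = f y" if "tw s t0 x" "tw s u y" "u \<noteq> t0" for x y u
  proof -
    have fx: "f x = (E x x1 = E x0 x1)" using that by (simp add: f_def)
    have fy: "f y = E x0 y" using that tw_unique E_sym by (metis f_def)
    show ?thesis
    \<comment> \<open>If \<open>y\<close> lies in the class of the reference \<open>x1\<close>, the
      two cannot occur in one triple of \<open>tw_triple\<close>, and \<open>x2\<close> serves as a
      bridge.\<close>
    proof (cases "u = t1")
      case True
      then show ?thesis
        using tw_triple[of s t0 x t1 x1 t2 x2] tw_triple[of s t0 x0 t1 x1 t2 x2]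
          tw_triple[of s t0 x t1 y t2 x2] tw_triple[of s t0 x0 t1 y t2 x2]
          x t0 t1 t2 that fx fy by metis
    next
      case False
      then show ?thesis
        using tw_triple[of s t0 x u y t1 x1] tw_triple[of s t0 x0 u y t1 x1]
          x t0 t1 t2 that fx fy by metis
    qed
  qed
  have "E x y \<longleftrightarrow> f x = f y" if "tw s t x" "tw s u y" "t \<noteq> u" for t u x y
  proof (cases "t = t0 \<or> u = t0")
    case True
    then show ?thesis using main that E_sym by metis
  next
    case False
    then have "f x = E x x0" "f y = E y x0" using that tw_unique unfolding f_def by meson+
    then show ?thesis using tw_triple[of s t x u y t0 x0] that False x by metis
  qed
  then have "coloring s f" unfolding coloring_def by blast
  show ?thesis by (rule exI[of _ f], fact)
qed

definition col :: "'a \<Rightarrow> 'a \<Rightarrow> bool" where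
  "col s = (SOME f. coloring s f)"

lemma col: "\<lbrakk>tw s t x; tw s u y; t \<noteq> u\<rbrakk> \<Longrightarrow> E x y \<longleftrightarrow> col s x = col s y"
  using someI_ex[OF coloring_exists[of s], folded col_def] twD(1)[of s t x] unfolding coloring_def by simp

text \<open>Different classes are covered by \<open>col\<close>. In one class, a vertex
  \<open>z\<close> of another class sees both or neither, so a non-adjacent pair gives a claw at
  \<open>z\<close> or at \<open>s\<close>.\<close>

lemma col_eq_adj:
  assumes "tw s t x" "tw s u y" "col s x = col s y" "x \<noteq> y"
  shows "E x y"
proof (rule ccontr)
  assume n: "\<not> E x y"
  then have ut: "u = t" using col assms by blast
  obtain v where v: "v \<in> S" "v \<noteq> s" "v \<noteq> t" using S_avoid3[of s t t] by blast
  then obtain z where z: "tw s v z" using tw_exists assms twD by metis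
  have *: "E z x \<longleftrightarrow> col s z = col s x" "E z y \<longleftrightarrow> col s z = col s y" using col[OF z assms(1)] col[OF z assms(2)] v ut by auto
  show False
  proof (cases "col s z = col s x")
    case True
    then show False
      using no_claw[of z x y v] * assms n v tw_only[of s t x v] tw_only[of s t y v] twD(5,9)[OF z] twD(9)[OF assms(1)] twD(9)[OF assms(2)]
      by (metis ut)
  next
    case False
    then show False
      using no_claw[of s x y z] * assms n v(3) tw_unique[OF z] E_sym twD(6)[OF z]
        twD(6)[OF assms(1)] twD(6)[OF assms(2)] by (metis ut)
  qed
qed

text \<open>The second witness \<open>x'\<close> reaches those \<open>y\<close> that lie in the
  class of \<open>x\<close> itself, where \<open>tw_si_triple\<close> does not apply to
  \<open>x\<close> and \<open>y\<close>.\<close>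

lemma tw_complete_class:
  assumes "tw s t x" "tw s t' x'" "t \<noteq> t'" "col s x = col s x'" "si s c" "E c x"
    "tw s u y" "col s y = col s x"
  shows "E c y"
proof -
  have "E c x'" using tw_si_triple[of s t x t' x' c] col assms by blast
  then show ?thesis
    using tw_si_triple[of s t x u y c] tw_si_triple[of s t' x' u y c] col assms by metis
qed

section \<open>W-joins from pairs of cliques\<close>

text \<open>The clique of root edges at one end of the edge \<open>s\<close>. Demanding completeness
  from the single-neighbour vertices is what makes it a clique before they have been given an
  end.\<close>

definition K :: "'a \<Rightarrow> bool \<Rightarrow> 'a set" where
  "K s p = insert s ({x. (\<exists>t. tw s t x) \<and> col s x = p} \<union>
     {c. si s c \<and> (\<forall>t x. tw s t x \<longrightarrow> col s x = p \<longrightarrow> E c x)})"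

lemma K_V: "s \<in> S \<Longrightarrow> K s p \<subseteq> V"
  using S_V unfolding K_def by (auto dest: twD(8) siD(4))

lemma K_cases:
  assumes "v \<in> K s p"
  obtains "v = s" | t where "tw s t v" "col s v = p"
  | "si s v" "\<And>t x. tw s t x \<Longrightarrow> col s x = p \<Longrightarrow> E v x"
  using assms unfolding K_def by auto

lemma K_clique:
  assumes "s \<in> S" "u \<in> K s p" "v \<in> K s p" "u \<noteq> v"
  shows "E u v"
  using assms(2)
proof (cases rule: K_cases)
  case 1
  from assms(3) show ?thesis
    by (cases rule: K_cases) (use 1 assms(4) twD(6) siD(3) in auto)
next
  case (2 t)
  from assms(3) show ?thesis
    by (cases rule: K_cases) (use 2 assms(4) twD(4) E_sym col_eq_adj in auto)
next
  case 3
  from assms(3) show ?thesis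
    by (cases rule: K_cases) (use 3 assms(4) siD(2) si_clique in auto)
qed

lemma K_tw:
  assumes "tw s t x"
  shows "x \<in> K s p \<longleftrightarrow> col s x = p"
  using assms tw_not_si[OF assms] twD(1,9)[OF assms] unfolding K_def by auto

text \<open>Claws at \<open>v\<close> with leaves \<open>b\<close> and \<open>w\<close> make
  \<open>w\<close> adjacent to the \<open>p\<close>-coloured vertices of two classes other than
  \<open>t\<close>. This forces \<open>w\<close> into \<open>K s p\<close> or makes it non-adjacent
  to \<open>v\<close>.\<close>

lemma strip_anticomplete:
  assumes st: "s \<in> S" "t \<in> S" "s \<noteq> t"
    and p: "\<And>u. \<lbrakk>u \<in> S; u \<noteq> s; u \<noteq> t\<rbrakk> \<Longrightarrow> \<exists>x. tw s u x \<and> col s x = p"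
    and b: "b \<in> K t q" "b \<notin> K s p" "\<And>w. E b w \<Longrightarrow> w \<in> K s p \<union> K t q"
    and v: "v \<in> K s p" "v \<notin> K t q" "E v b"
    and w: "E v w" "w \<notin> K s p" "w \<notin> K t q"
  shows False
proof -
  \<comment> \<open>Any other type of \<open>b\<close> would have a neighbour in \<open>S\<close>
    outside both cliques.\<close>
  have b_cases: "b = t \<or> si t b \<or> (tw s t b \<and> col s b \<noteq> p)"
    using b(1)
  proof (cases rule: K_cases)
    case (2 u)
    show ?thesis
    proof (cases "u = s")
      case True
      then show ?thesis using 2 b(2) K_tw tw_sym by blast
    next
      case False
      have "u \<in> K s p \<union> K t q" using b(3)[of u] 2 twD by blast
      moreover have "u \<in> S" "u \<noteq> t" using 2 twD by blast+
      ultimately show ?thesis using False unfolding K_def using twD(9) siD(5) by blast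
    qed
  qed auto
  have v_cases: "v = s \<or> si s v \<or> tw s t v"
    using v(1)
  proof (cases rule: K_cases)
    case (2 u)
    have "tw s t v" if "u \<noteq> t"
    proof -
      from b_cases show ?thesis
      proof (elim disjE conjE)
        assume "b = t"
        then show ?thesis using v(3) 2 tw_only[of s u v t] st that by blast
      next
        assume "si t b"
        then show ?thesis using si_tw_nonadj[of t b s u v] 2 that st v(3) by blast
      next
        assume "tw s t b" "col s b \<noteq> p"
        then show ?thesis using col[of s u v t b] 2 that v(3) by blast
      qed
    qed
    then show ?thesis using 2 by blast
  qed auto
  have wb: "\<not> E w b" "w \<noteq> b" using b(3)[of w] b(1) w E_sym by blast+
  obtain k1 where k1: "k1 \<in> S" "k1 \<noteq> s" "k1 \<noteq> t" using S_avoid3[of s t t] by blast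
  obtain k2 where k2: "k2 \<in> S" "k2 \<noteq> s" "k2 \<noteq> t" "k2 \<noteq> k1" using S_avoid3[of s t k1] by blast
  obtain x1 x2 where x1: "tw s k1 x1" "col s x1 = p" and x2: "tw s k2 x2" "col s x2 = p"
    using p k1 k2 by metis
  have ub: "\<not> E u b \<and> u \<noteq> b" if u: "tw s k u" "k \<noteq> t" "col s u = p" for u k
    using b_cases
  proof (elim disjE conjE)
    assume "b = t"
    then show ?thesis using tw_only[of s k u t] u st twD by metis
  next
    assume "si t b"
    then show ?thesis using si_tw_nonadj[of t b s k u] u st b(2) K_tw by blast
  next
    assume "tw s t b" "col s b \<noteq> p"
    then show ?thesis using col[of s k u t b] u by blast
  qed
  have uw: "E u w" if u: "tw s k u" "k \<noteq> t" "col s u = p" for u k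
  proof (rule ccontr)
    assume "\<not> E u w"
    moreover have "u \<in> K s p" using u K_tw by blast
    moreover have "u \<noteq> v" using u v(3) ub by blast
    ultimately show False
      using no_claw[of v u b w] K_clique[of s v p u] v w wb ub[OF u] st E_sym by metis
  qed
  have xw: "E x1 w" "E x2 w" using uw x1 x2 k1 k2 by blast+
  have ws: "w \<noteq> s" using w(2) unfolding K_def by blast
  show False
  proof (cases "w \<in> S")
    case True
    then show False using tw_only[of s k1 x1 w] tw_only[of s k2 x2 w] xw x1 x2 k2 ws by blast
  next
    case False
    have "w \<in> V" using w(1) E_sym E_V by blast
    then show False using False
    proof (cases rule: outside_cases)
      case (1 m)
      have "m = s"
        using si_tw_nonadj[of m w s k1 x1] si_tw_nonadj[of m w s k2 x2] 1 xw x1 x2 k2 by blast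
      then have "w \<in> K s p"
        using 1 tw_complete_class[of s k1 x1 k2 x2 w] x1 x2 k2 xw E_sym unfolding K_def by blast
      then show False using w by blast
    next
      case (2 m n)
      show False
      proof (cases "m = s \<or> n = s")
        case True
        then obtain n' where n': "tw s n' w" using 2 tw_sym by blast
        then have "col s w \<noteq> p" using K_tw w by blast
        then show False using col[of s k1 x1 n' w] col[of s k2 x2 n' w] n' x1 x2 xw k2 by blast
      next
        case False
        \<comment> \<open>Not seeing \<open>s\<close>, the vertex \<open>w\<close> can be adjacent
          to \<open>x1\<close> and \<open>x2\<close> only by seeing both \<open>k1\<close> and
          \<open>k2\<close>.\<close>
        have a: "{m, n} = {k1, k2}"
          using tw_disjoint_nonadj[of s k1 x1 m n w] tw_disjoint_nonadj[of s k2 x2 m n w]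
            False x1 x2 xw 2 k2 twD(3)[of m n w] by blast
        from v_cases show False
        proof (elim disjE)
          assume "v = s"
          then show False using tw_only[of m n w s] 2 w E_sym False st by blast
        next
          assume "si s v"
          then show False using si_tw_nonadj[of s v m n w] 2 False w by blast
        next
          assume "tw s t v"
          then show False using tw_disjoint_nonadj[of s t v m n w] 2 False a k1 k2 w
            by (metis doubleton_eq_iff)
        qed
      qed
    qed
  qed
qed

text \<open>
  Vertices of \<open>K s p \<union> K t q\<close> without neighbours outside form a homogeneous pair of cliques.
\<close>
lemma strip_W_join:
  assumes st: "s \<in> S" "t \<in> S" "s \<noteq> t"
    and p: "\<And>u. \<lbrakk>u \<in> S; u \<noteq> s; u \<noteq> t\<rbrakk> \<Longrightarrow> \<exists>x. tw s u x \<and> col s x = p"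
    and q: "\<And>u. \<lbrakk>u \<in> S; u \<noteq> s; u \<noteq> t\<rbrakk> \<Longrightarrow> \<exists>x. tw t u x \<and> col t x = q"
    and a: "a \<in> K s p" "a \<notin> K t q" "\<And>w. E a w \<Longrightarrow> w \<in> K s p \<union> K t q"
    and a': "a' \<in> K s p" "a' \<notin> K t q" "\<And>w. E a' w \<Longrightarrow> w \<in> K s p \<union> K t q"
    and b: "b \<in> K t q" "b \<notin> K s p" "\<And>w. E b w \<Longrightarrow> w \<in> K s p \<union> K t q"
    and b': "b' \<in> K t q" "b' \<notin> K s p" "\<And>w. E b' w \<Longrightarrow> w \<in> K s p \<union> K t q"
    and e: "E a b" "\<not> E a' b'"
  shows False
proof -
  define A where "A = {v. v \<in> K s p \<and> v \<notin> K t q \<and> (\<forall>w. E v w \<longrightarrow> w \<in> K s p \<union> K t q)}"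
  define B where "B = {v. v \<in> K t q \<and> v \<notin> K s p \<and> (\<forall>w. E v w \<longrightarrow> w \<in> K s p \<union> K t q)}"
  note AB = A_def B_def
  have hom: "(\<forall>a\<in>A. E v a) \<or> (\<forall>a\<in>A. \<not> E v a)" "(\<forall>b\<in>B. E v b) \<or> (\<forall>b\<in>B. \<not> E v b)"
    if v: "v \<in> V" "v \<notin> A" "v \<notin> B" for v
  proof -
    have KA: "v \<in> K s p \<Longrightarrow> \<forall>a\<in>A. E v a"
      using K_clique[of _ v] st v unfolding A_def B_def by blast
    have KB: "v \<in> K t q \<Longrightarrow> \<forall>a\<in>B. E v a"
      using K_clique[of _ v] st v unfolding A_def B_def by blast
    \<comment> \<open>A vertex of exactly one clique that was left out of \<open>A\<close> and
      \<open>B\<close> has a neighbour outside the strip, so \<open>strip_anticomplete\<close>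
      applies to it.\<close>
    have out: "\<exists>w. E v w \<and> w \<notin> K s p \<and> w \<notin> K t q" if "(v \<in> K s p) \<noteq> (v \<in> K t q)"
      using v that unfolding AB by blast
    have 1: "\<forall>b\<in>B. \<not> E v b" if "v \<in> K s p" "v \<notin> K t q"
      using out strip_anticomplete[of s t p _ q v] st p that unfolding AB by blast
    have 2: "\<forall>b\<in>A. \<not> E v b" if "v \<in> K t q" "v \<notin> K s p"
      using out strip_anticomplete[of t s q _ p v] st q that unfolding AB by blast
    have 3: "\<forall>b\<in>A \<union> B. \<not> E v b" if "v \<notin> K t q" "v \<notin> K s p"
      using that E_sym unfolding AB by blast
    show "(\<forall>a\<in>A. E v a) \<or> (\<forall>a\<in>A. \<not> E v a)" "(\<forall>b\<in>B. E v b) \<or> (\<forall>b\<in>B. \<not> E v b)"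
      using KA KB 1 2 3 by blast+
  qed
  show False
  proof (rule no_W_join[of A B a b a' b'])
    show "A \<subseteq> V" "B \<subseteq> V" using K_V st unfolding AB by blast+
    show "\<And>a a'. \<lbrakk>a \<in> A; a' \<in> A; a \<noteq> a'\<rbrakk> \<Longrightarrow> E a a'" "\<And>a a'. \<lbrakk>a \<in> B; a' \<in> B; a \<noteq> a'\<rbrakk> \<Longrightarrow> E a a'"
      using K_clique[OF st(1)] K_clique[OF st(2)] unfolding AB by blast+
    show "A \<inter> B = {}" "a \<in> A" "a' \<in> A" "b \<in> B" "b' \<in> B"
      using a a' b b' unfolding AB by blast+
  qed (use e hom in auto)
qed

section \<open>Neighbours forced by diameter two and unnested neighbourhoods\<close>

lemma S_K: "\<lbrakk>u \<in> S; u \<in> K s p\<rbrakk> \<Longrightarrow> u = s"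
  unfolding K_def using twD(9) siD(5) by blast

lemma si_K:
  assumes "si s c" "c \<in> K t q" "t \<in> S"
  shows "s = t"
  using assms(2)
proof (cases rule: K_cases)
  case 1
  then show ?thesis using assms siD(5) by blast
next
  case (2 u)
  then show ?thesis using assms tw_not_si by blast
next
  case 3
  then show ?thesis using assms siD(1,2) si_only by blast
qed

text \<open>The vertices \<open>x\<close> and \<open>u\<close> have a common neighbour, and the
  non-adjacency lemmas leave only these types for it.\<close>

lemma tw_nbr:
  assumes "tw s t x" "u \<in> S" "u \<noteq> s" "u \<noteq> t"
  shows "\<exists>z. (tw s u z \<or> tw t u z) \<and> E x z"
proof -
  have "\<not> E x u" using assms tw_only by blast
  then obtain w where w: "E x w" "E w u"
    using diam[of x u] assms twD(8,9) S_V by blast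
  have "w \<in> V" "w \<notin> S" using w E_V S_indep assms by blast+
  then show ?thesis
  proof (cases rule: outside_cases)
    case (1 m)
    then show ?thesis using si_only[of m w u] si_tw_nonadj[of m w s t x] w assms by blast
  next
    case (2 m n)
    then have "u = m \<or> u = n" using tw_only w assms by blast
    then obtain k where k: "tw k u w" using 2 tw_sym by blast
    then have "k = s \<or> k = t" using tw_disjoint_nonadj[OF assms(1), of k u w] w assms by blast
    then show ?thesis using k w by blast
  qed
qed

lemma si_nbr:
  assumes "si s c" "u \<in> S" "u \<noteq> s"
  shows "\<exists>z. (tw s u z \<or> si u z) \<and> E c z"
proof -
  have "\<not> E c u" using assms si_only by blast
  then obtain w where w: "E c w" "E w u"
    using diam[of c u] assms siD(4,5) S_V by blast
  have "w \<in> V" "w \<notin> S" using w E_V S_indep assms by blast+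
  then show ?thesis
  proof (cases rule: outside_cases)
    case (1 m)
    then show ?thesis using si_only[of m w u] w assms by blast
  next
    case (2 m n)
    then have "u = m \<or> u = n" using tw_only w assms by blast
    then obtain k where k: "tw k u w" using 2 tw_sym by blast
    then have "k = s" using si_tw_nonadj[OF assms(1) k] w assms by blast
    then show ?thesis using k w by blast
  qed
qed

text \<open>Some neighbour of \<open>c\<close> is missed by \<open>s\<close>. If it saw two vertices
  of \<open>S\<close>, adjacency to \<open>c\<close> would force \<open>s\<close> to be one of
  them.\<close>

lemma outer_exists:
  assumes "si s c"
  shows "\<exists>t d. si t d \<and> t \<noteq> s \<and> E c d"
proof -
  obtain d where d: "E c d" "d \<noteq> s" "\<not> E s d"
    using not_nested[of c s] siD(2)[OF assms] by blast
  have "d \<in> V" "d \<notin> S" using d si_only[OF assms] E_sym E_V by blast+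
  then show ?thesis
    using d assms si_tw_nonadj[OF assms] siD(3) twD(6,7) by (metis outside_cases)
qed

lemma si_not_dominating:
  assumes "si s c"
  shows "\<exists>t x. tw s t x \<and> \<not> E c x"
proof -
  obtain d where d: "E s d" "d \<noteq> c" "\<not> E c d"
    using not_nested[of s c] siD(3)[OF assms] by blast
  have "d \<in> V" "d \<notin> S" using d siD(1)[OF assms] S_indep E_sym E_V by blast+
  then show ?thesis
  proof (cases rule: outside_cases)
    case (1 m)
    then have "m = s" using d siD(1)[OF assms] E_sym si_only by metis
    then show ?thesis using 1 d si_clique assms by blast
  next
    case (2 m n)
    then have "s = m \<or> s = n" using d siD(1)[OF assms] E_sym tw_only by metis
    then show ?thesis using 2 d tw_sym by blast
  qed
qed

text \<open>Otherwise \<open>c\<close> is the centre of a claw with leaves \<open>d\<close>,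
  \<open>e\<close>, \<open>s\<close>.\<close>

lemma outer_trans:
  assumes "si s c" "si t d" "si u e" "s \<noteq> t" "s \<noteq> u" "t \<noteq> u" "E c d" "E c e"
  shows "E d e"
proof (rule ccontr)
  assume "\<not> E d e"
  moreover have "\<not> E d s" "\<not> E e s" using assms siD(1) si_only by metis+
  moreover have "d \<noteq> e" using assms(2,3,6) siD(1,2) si_only by metis
  ultimately show False
    using no_claw[of c d e s] assms siD(1,2,5) by metis
qed

section \<open>No adjacency inside \<open>tw s t\<close> between opposite colours\<close>

text \<open>Both \<open>z\<close> and \<open>w\<close> agree with \<open>x\<close> at their ends and
  hence miss \<open>y\<close>; a claw at \<open>x\<close> with leaves \<open>y\<close>,
  \<open>z\<close>, \<open>w\<close> must be avoided.\<close>

lemma opposite_pair_adj: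
  assumes "tw s t x" "tw s t y" "E x y" "col s x \<noteq> col s y" "col t x \<noteq> col t y"
    "tw s u z" "col s z = col s x" "u \<noteq> t" "tw t v w" "col t w = col t x" "v \<noteq> s"
  shows "E z w"
proof (rule ccontr)
  assume n: "\<not> E z w"
  have "x \<noteq> z" "x \<noteq> w" using assms tw_unique tw_sym by blast+
  then have "E x z" "E x w" using col_eq_adj assms tw_sym by metis+
  moreover have "\<not> E y z" "\<not> E y w" using col assms tw_sym by metis+
  moreover have "y \<noteq> z" "y \<noteq> w" using assms by auto
  moreover have "z \<noteq> w"
    using tw_only[OF assms(6), of t] twD(2,3,4)[OF assms(9)] assms(1,8) twD(1-3) by blast
  ultimately show False using no_claw[of x y z w] assms(3) n by blast
qed

text \<open>The strip is indexed crosswise: \<open>y\<close> belongs to the clique at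
  \<open>s\<close> and \<open>x\<close> to the one at \<open>t\<close>, since these are the colours
  of all other classes.\<close>

lemma opposite_pair_closed:
  assumes xy: "tw s t x" "tw s t y" "E x y" "col s x \<noteq> col s y" "col t x \<noteq> col t y"
    and s: "\<And>u z. \<lbrakk>tw s u z; u \<noteq> t\<rbrakk> \<Longrightarrow> col s z = col s y"
    and t: "\<And>u z. \<lbrakk>tw t u z; u \<noteq> s\<rbrakk> \<Longrightarrow> col t z = col t x"
  shows "\<And>w. E x w \<Longrightarrow> w \<in> K s (col s y) \<union> K t (col t x)"
    and "\<And>w. E s w \<Longrightarrow> w \<in> K s (col s y) \<union> K t (col t x)"
proof -
  let ?K = "K s (col s y) \<union> K t (col t x)"
  have st: "s \<in> S" "t \<in> S" "s \<noteq> t" using twD xy(1) by blast+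
  obtain u where u: "u \<in> S" "u \<noteq> s" "u \<noteq> t" using S_avoid3[of s t t] by blast
  obtain z1 z2 where z: "tw s u z1" "tw t u z2" using tw_exists st u by metis
  have zc: "col s z1 = col s y" "col t z2 = col t x" using s t z u by blast+
  \<comment> \<open>The neighbour that \<open>tw_nbr\<close> provides carries a colour of the strip,
    and \<open>w\<close> has to share it.\<close>
  have tw_st: "w \<in> ?K" if w: "tw s t w" for w
  proof (rule ccontr)
    assume "w \<notin> ?K"
    then have n: "col s w \<noteq> col s y" "col t w \<noteq> col t x"
      using K_tw[OF w] K_tw[OF tw_sym[OF w]] by blast+
    obtain z where "tw s u z \<or> tw t u z" "E w z" using tw_nbr[OF w u] by blast
    then show False using col[OF w, of u z] col[OF tw_sym[OF w], of u z] s t u n by metis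
  qed
  have si_s: "E c z1 \<Longrightarrow> c \<in> ?K" "E c y \<Longrightarrow> c \<in> ?K" if "si s c" for c
  proof -
    have "c \<in> K s (col s y)" if "E c z1 \<or> E c y"
      using that tw_complete_class[OF xy(2) z(1) _ _ \<open>si s c\<close>]
        tw_complete_class[OF z(1) xy(2) _ _ \<open>si s c\<close>] zc u \<open>si s c\<close>
      unfolding K_def by blast
    then show "E c z1 \<Longrightarrow> c \<in> ?K" "E c y \<Longrightarrow> c \<in> ?K" by blast+
  qed
  have x_si_s: "w \<in> ?K" if "si s w" "E x w" for w
  proof (rule ccontr)
    assume n: "w \<notin> ?K"
    have "\<not> E w y" using si_s n that by blast
    moreover have "\<not> E w z2" using si_tw_nonadj[OF that(1) z(2)] st u by blast
    moreover have "E x z2" using col[OF tw_sym[OF xy(1)] z(2)] zc u by blast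
    moreover have "\<not> E y z2" using col[OF tw_sym[OF xy(2)] z(2)] zc u xy by blast
    ultimately show False
      using no_claw[of x y w z2] xy that z E_sym tw_not_si[OF xy(2)] tw_not_si[OF z(2)] zc
      by metis
  qed
  show "w \<in> ?K" if w: "E x w" for w
  proof (cases "w \<in> S")
    case True
    then show ?thesis using tw_only[OF xy(1)] w unfolding K_def by blast
  next
    case False
    have "w \<in> V" using w E_sym E_V by blast
    then show ?thesis using False
    proof (cases rule: outside_cases)
      case (1 m)
      then consider "m = s" | "m = t" using si_tw_nonadj[OF 1 xy(1)] w by blast
      then show ?thesis
      proof cases
        case 1
        then show ?thesis using \<open>si m w\<close> x_si_s w by blast
      next
        case 2
        then have "w \<in> K t (col t x)"
          using tw_complete_class[OF tw_sym[OF xy(1)] z(2)] zc u \<open>si m w\<close> w E_sym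
          unfolding K_def by blast
        then show ?thesis by blast
      qed
    next
      case (2 m n)
      have "m = s \<or> m = t \<or> n = s \<or> n = t"
        using tw_disjoint_nonadj[OF xy(1) 2] w by blast
      then obtain k where "tw s k w \<or> tw t k w" using 2 tw_sym by blast
      then consider "tw s t w" | "tw s k w" "k \<noteq> t" | "tw t k w" "k \<noteq> s"
        using tw_sym by blast
      then show ?thesis
      proof cases
        case 1
        then show ?thesis using tw_st by blast
      next
        case 2
        then show ?thesis using col[OF xy(1) 2(1)] s w xy(4) by blast
      next
        case 3
        then show ?thesis using t K_tw by blast
      qed
    qed
  qed
  then have x_closed: "w \<in> ?K" if "E x w" for w using that by blast
  show "w \<in> ?K" if w: "E s w" for w
  proof -
    have "w \<in> V" "w \<notin> S" using w E_sym E_V S_indep st by blast+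
    then show ?thesis
    proof (cases rule: outside_cases)
      case (1 m)
      then have m: "m = s" using si_only[OF 1 st(1)] w E_sym by blast
      have "\<not> E x z1" using col[OF xy(1) z(1)] zc u xy(4) by blast
      moreover have "x \<noteq> z1" using zc xy(4) by blast
      ultimately have "E w x \<or> E w z1" using nonadj_si[OF xy(1) z(1)] 1 m by blast
      then show ?thesis using x_closed si_s 1 m E_sym by blast
    next
      case (2 m n)
      then have "m = s \<or> n = s" using tw_only[OF 2 st(1)] w E_sym by blast
      then obtain k where k: "tw s k w" using 2 tw_sym by blast
      then show ?thesis using tw_st s K_tw by (cases "k = t") blast+
    qed
  qed
qed

lemma opposite_pair_strip:
  assumes xy: "tw s t x" "tw s t y" "E x y" "col s x \<noteq> col s y" "col t x \<noteq> col t y"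
    and s: "\<And>u z. \<lbrakk>tw s u z; u \<noteq> t\<rbrakk> \<Longrightarrow> col s z = col s y"
    and t: "\<And>u z. \<lbrakk>tw t u z; u \<noteq> s\<rbrakk> \<Longrightarrow> col t z = col t x"
  shows False
proof -
  have st: "s \<in> S" "t \<in> S" "s \<noteq> t" using twD xy(1) by blast+
  note xy' = tw_sym[OF xy(2)] tw_sym[OF xy(1)] E_sym[OF xy(3)] xy(5)[symmetric] xy(4)[symmetric]
  let ?K = "K s (col s y) \<union> K t (col t x)"
  have cx: "E x w \<Longrightarrow> w \<in> ?K" "E s w \<Longrightarrow> w \<in> ?K" for w
    using opposite_pair_closed[OF xy] s t by blast+
  have cy: "E y w \<Longrightarrow> w \<in> ?K" "E t w \<Longrightarrow> w \<in> ?K" for w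
    using opposite_pair_closed[OF xy'] s t by blast+
  show False
  \<comment> \<open>The W-join is witnessed by the edge \<open>y x\<close> and the non-edge
    \<open>s t\<close>. Closure for \<open>y\<close> and \<open>t\<close> comes from exchanging both
    pairs of roles.\<close>
  proof (rule strip_W_join[of s t "col s y" "col t x" y s x t])
    show "s \<in> S" "t \<in> S" "s \<noteq> t" by fact+
    show "\<exists>x. tw s u x \<and> col s x = col s y" if "u \<in> S" "u \<noteq> s" "u \<noteq> t" for u
      using tw_exists[OF st(1) that(1)] s that by blast
    show "\<exists>z. tw t u z \<and> col t z = col t x" if "u \<in> S" "u \<noteq> s" "u \<noteq> t" for u
      using tw_exists[OF st(2) that(1)] t that by blast
    show "y \<in> K s (col s y)" "x \<notin> K s (col s y)" "x \<in> K t (col t x)" "y \<notin> K t (col t x)"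
      using K_tw xy xy' by metis+
    show "s \<in> K s (col s y)" "t \<in> K t (col t x)" unfolding K_def by blast+
    show "s \<notin> K t (col t x)" "t \<notin> K s (col s y)" using S_K st by blast+
    show "E y x" "\<not> E s t" using xy' S_indep st by blast+
  qed (fact cx cy)+
qed

text \<open>If \<open>c\<close> saw \<open>y\<close>, it would see \<open>z\<close> and be the
  centre of a claw with leaves \<open>c'\<close>, \<open>x\<close>, \<open>z\<close>; otherwise
  \<open>x\<close> is the centre of one with leaves \<open>c\<close>, \<open>y\<close>,
  \<open>w\<close>.\<close>

lemma opposite_pair_no_si:
  assumes xy: "tw s t x" "tw s t y" "E x y" "col s x \<noteq> col s y" "col t x \<noteq> col t y"
    and u: "u \<noteq> s" "u \<noteq> t" "v \<noteq> t" "u \<noteq> v"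
    and z: "tw s v z" "col s z = col s y" and w: "tw t u w" "col t w = col t x"
    and c: "si s c" "E c x" "si u c'" "E c c'"
  shows False
proof -
  have nz: "\<not> E x z" "E y z" using col[OF xy(1) z(1)] col[OF xy(2) z(1)] z u xy by blast+
  have "\<not> E c y"
  proof
    assume "E c y"
    then have "E c z" using tw_si_triple[OF xy(2) z(1)] nz c u by blast
    moreover have "\<not> E c' x" "\<not> E c' z"
      using si_tw_nonadj[OF c(3) xy(1)] si_tw_nonadj[OF c(3) z(1)] u by blast+
    moreover have "x \<noteq> z" "c' \<noteq> x" "c' \<noteq> z"
      using z xy c tw_not_si by metis+
    ultimately show False using no_claw[of c c' x z] c nz by blast
  qed
  moreover have "\<not> E c w"
    using si_tw_nonadj[OF c(1) w(1)] twD(3)[OF xy(1)] u by blast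
  moreover have "E x w" "\<not> E y w"
    using col[OF tw_sym[OF xy(1)] w(1)] col[OF tw_sym[OF xy(2)] w(1)] w u xy(5) by blast+
  moreover have "c \<noteq> y" "c \<noteq> w" "y \<noteq> w" using xy w c tw_not_si by metis+
  ultimately show False using no_claw[of x c y w] c xy(3) E_sym by blast
qed

text \<open>The exceptional configuration with four vertices in \<open>S\<close>. All two-neighbour
  vertices at \<open>u\<close> get one colour, so unnestedness of \<open>u\<close> and
  \<open>e\<close> yields a single-neighbour vertex \<open>d\<close> at \<open>u\<close>; it then
  has no common neighbour with \<open>x\<close>.\<close>

lemma opposite_pair_four:
  assumes xy: "tw s t x" "tw s t y" "E x y" "col s x \<noteq> col s y" "col t x \<noteq> col t y"
    and S: "S \<subseteq> {s, t, u, v}" "u \<in> S" "v \<in> S" "u \<noteq> s" "u \<noteq> t" "v \<noteq> s" "v \<noteq> t" "u \<noteq> v"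
    and su: "\<And>z. tw s u z \<Longrightarrow> col s z = col s x" and tu: "\<And>z. tw t u z \<Longrightarrow> col t z = col t x"
    and sv: "\<And>z. tw s v z \<Longrightarrow> col s z = col s y" and tv: "\<And>z. tw t v z \<Longrightarrow> col t z = col t y"
  shows False
proof -
  have st: "s \<in> S" "t \<in> S" "s \<noteq> t" using twD xy(1) by blast+
  obtain zsu ztu zsv ztv where z: "tw s u zsu" "tw t u ztu" "tw s v zsv" "tw t v ztv"
    using tw_exists st S by metis
  obtain e where e: "tw u v e" using tw_exists S by blast
  have mix: "col u a = col u b" if "tw s u a" "tw t u b" for a b
    using opposite_pair_adj[OF xy that(1) su[OF that(1)] S(5) that(2) tu[OF that(2)] S(4)]
      col[OF tw_sym[OF that(1)] tw_sym[OF that(2)]] st by blast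
  have cstu: "col u a = col u zsu" if "tw s u a \<or> tw t u a" for a
    using that mix z by metis
  \<comment> \<open>A common neighbour of \<open>a\<close> and \<open>x\<close> must see
    \<open>u\<close> together with \<open>s\<close> or \<open>t\<close>, because the classes of
    \<open>v\<close> at \<open>s\<close> and \<open>t\<close> have the colours of \<open>y\<close>.
    It passes its colour at \<open>u\<close> on to \<open>a\<close>.\<close>
  have e_col: "col u a = col u zsu" if a: "tw u v a" for a
  proof -
    have "\<not> E a x" using tw_disjoint_nonadj[OF a xy(1)] S by blast
    moreover have "a \<noteq> x" using tw_only[OF xy(1) S(2)] twD(4)[OF a] S by blast
    ultimately obtain w where w: "E a w" "E w x"
      using diam[of a x] twD(8) a xy(1) by blast
    have "w \<notin> S" using tw_only[OF a] tw_only[OF xy(1)] w E_sym S by blast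
    have "w \<in> V" using w E_V by blast
    from this \<open>w \<notin> S\<close> show ?thesis
    proof (cases rule: outside_cases)
      case (1 m)
      then show ?thesis
        using si_tw_nonadj[OF 1 a] si_tw_nonadj[OF 1 xy(1)] w S by blast
    next
      case (2 m n)
      have "{m, n} \<inter> {s, t} \<noteq> {}" "{m, n} \<inter> {u, v} \<noteq> {}"
        using tw_disjoint_nonadj[OF 2 xy(1)] tw_disjoint_nonadj[OF a 2] w by blast+
      then have "tw s u w \<or> tw t u w \<or> tw s v w \<or> tw t v w"
        using 2 tw_sym S by blast
      moreover have "\<not> tw s v w"
        using col[OF xy(1), of v w] sv w xy(4) S E_sym by metis
      moreover have "\<not> tw t v w"
        using col[OF tw_sym[OF xy(1)], of v w] tv w xy(5) S E_sym by metis
      ultimately have k: "tw s u w \<or> tw t u w" by blast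
      then show ?thesis
        using cstu[OF k] col[OF a, of s w] col[OF a, of t w] tw_sym[of _ u w] w S by metis
    qed
  qed
  have Mu: "col u a = col u zsu" if a: "tw u k a" for a k
  proof -
    have "k = s \<or> k = t \<or> k = v" using twD(2,3)[OF a] S by blast
    then show ?thesis using cstu e_col a tw_sym by blast
  qed
  obtain d where d: "E u d" "d \<noteq> e" "\<not> E e d"
    using not_nested[of u e] twD(6)[OF e] by blast
  have "d \<in> V" "d \<notin> S" using d S S_indep E_sym E_V by blast+
  then obtain "si u d"
  proof (cases rule: outside_cases)
    case (1 m)
    then show ?thesis using that si_only[OF 1 S(2)] d E_sym by blast
  next
    case (2 m n)
    then have "m = u \<or> n = u" using tw_only[OF 2 S(2)] d E_sym by blast
    then obtain k where k: "tw u k d" using 2 tw_sym by blast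
    then show ?thesis using Mu[OF k] Mu[OF e] col_eq_adj[OF e k] d by metis
  qed
  \<comment> \<open>One adjacency would spread over the whole colour class, which contains
    \<open>e\<close>.\<close>
  have anti: "\<not> E d a" if a: "tw u k a" for a k
  proof
    assume da: "E d a"
    obtain k' where k': "k' \<in> S" "k' \<noteq> u" "k' \<noteq> k" using S_avoid3[of u k k] by blast
    obtain a' where a': "tw u k' a'" using tw_exists S k' by metis
    have "E d e"
      using tw_complete_class[OF a a' _ _ \<open>si u d\<close> da e] k' Mu[OF a] Mu[OF a'] Mu[OF e] by metis
    then show False using d E_sym by blast
  qed
  have "\<not> E d x" using si_tw_nonadj[OF \<open>si u d\<close> xy(1)] S by blast
  moreover have "d \<noteq> x" using tw_not_si xy(1) \<open>si u d\<close> by blast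
  ultimately obtain c where c: "E d c" "E c x"
    using diam[of d x] twD(8)[OF xy(1)] siD(4)[OF \<open>si u d\<close>] by blast
  have "c \<notin> S" using si_only[OF \<open>si u d\<close>] tw_only[OF xy(1)] c E_sym S by blast
  have "c \<in> V" using c E_V by blast
  from this \<open>c \<notin> S\<close> show False
  proof (cases rule: outside_cases)
    case (1 m)
    then have "m = s \<or> m = t" using si_tw_nonadj[OF 1 xy(1)] c by blast
    moreover have "E c d" using c E_sym by blast
    ultimately show False
      using opposite_pair_no_si[OF xy S(4,5) S(7,8) z(3) sv[OF z(3)] z(2) tu[OF z(2)], of c d]
        opposite_pair_no_si[OF tw_sym[OF xy(1)] tw_sym[OF xy(2)] xy(3,5,4) S(5,4) S(6,8) z(4) tv[OF z(4)] z(1) su[OF z(1)], of c d]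
        1 c \<open>si u d\<close> by blast
  next
    case (2 m n)
    then have "m = u \<or> n = u" using si_tw_nonadj[OF \<open>si u d\<close> 2] c by blast
    then show False using anti c 2 tw_sym by blast
  qed
qed

lemma tw_opposite_nonadj:
  assumes xy: "tw s t x" "tw s t y" "col s x \<noteq> col s y" "col t x \<noteq> col t y"
  shows "\<not> E x y"
proof
  assume E: "E x y"
  note xy1 = xy(1,2) E xy(3,4)
  note xy2 = xy(2,1) E_sym[OF E] xy(3)[symmetric] xy(4)[symmetric]
  have st: "s \<in> S" "t \<in> S" "s \<noteq> t" using twD xy(1) by blast+
  \<comment> \<open>Unprimed predicates record agreement with \<open>x\<close>, primed ones with
    \<open>y\<close>; \<open>P\<close> is about the end at \<open>s\<close> and \<open>Q\<close>
    about the end at \<open>t\<close>.\<close>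
  define P P' Q Q' where "P u = (\<exists>z. tw s u z \<and> col s z = col s x)"
    and "P' u = (\<exists>z. tw s u z \<and> col s z = col s y)"
    and "Q u = (\<exists>z. tw t u z \<and> col t z = col t x)"
    and "Q' u = (\<exists>z. tw t u z \<and> col t z = col t y)" for u
  note defs = P_def P'_def Q_def Q'_def
  define R where "R = S - {s, t}"
  have R: "u \<in> R \<longleftrightarrow> u \<in> S \<and> u \<noteq> s \<and> u \<noteq> t" for u unfolding R_def by blast
  have ex: "P u \<or> P' u" "Q u \<or> Q' u" if "u \<in> R" for u
    using tw_exists[OF st(1)] tw_exists[OF st(2)] that xy(3,4) unfolding R defs by metis+
  \<comment> \<open>The two witnesses would be adjacent by \<open>opposite_pair_adj\<close> and
    non-adjacent by \<open>tw_disjoint_nonadj\<close>.\<close>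
  have PQ: "\<not> (P u \<and> Q v)" "\<not> (P' u \<and> Q' v)" if "u \<in> R" "v \<in> R" "u \<noteq> v" for u v
  proof -
    have "\<not> E z w" if "tw s u z" "tw t v w" for z w
      using tw_disjoint_nonadj[OF that] st \<open>u \<in> R\<close> \<open>v \<in> R\<close> \<open>u \<noteq> v\<close> R by blast
    then show "\<not> (P u \<and> Q v)" "\<not> (P' u \<and> Q' v)"
      using opposite_pair_adj[OF xy1, of u _ v] opposite_pair_adj[OF xy2, of u _ v] that unfolding R defs by metis+
  qed
  have strip1: "\<exists>u\<in>R. P u \<or> Q' u"
  proof (rule ccontr)
    assume n: "\<not> ?thesis"
    have "col s z = col s y" if "tw s u z" "u \<noteq> t" for u z
      using n that twD(2,3)[OF that(1)] xy(3) R[of u] unfolding defs by blast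
    moreover have "col t z = col t x" if "tw t u z" "u \<noteq> s" for u z
      using n that twD(2,3)[OF that(1)] xy(4) R[of u] unfolding defs by blast
    ultimately show False using opposite_pair_strip[OF xy1] by blast
  qed
  have strip2: "\<exists>u\<in>R. P' u \<or> Q u"
  proof (rule ccontr)
    assume n: "\<not> ?thesis"
    have "col s z = col s x" if "tw s u z" "u \<noteq> t" for u z
      using n that twD(2,3)[OF that(1)] xy(3) R[of u] unfolding defs by blast
    moreover have "col t z = col t y" if "tw t u z" "u \<noteq> s" for u z
      using n that twD(2,3)[OF that(1)] xy(4) R[of u] unfolding defs by blast
    ultimately show False using opposite_pair_strip[OF xy2] by blast
  qed
  have four: "P' u \<or> Q' u \<or> P v \<or> Q v" if "R \<subseteq> {u, v}" "u \<in> R" "v \<in> R" "u \<noteq> v" for u v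
  proof -
    have "S \<subseteq> {s, t, u, v}" using that R by blast
    show ?thesis
    proof (rule ccontr)
      assume n: "\<not> ?thesis"
      show False
      proof (rule opposite_pair_four[OF xy1 \<open>S \<subseteq> {s, t, u, v}\<close>])
        show "u \<in> S" "v \<in> S" "u \<noteq> s" "u \<noteq> t" "v \<noteq> s" "v \<noteq> t" "u \<noteq> v"
          using that R by auto
        show "tw s u z \<Longrightarrow> col s z = col s x" "tw t u z \<Longrightarrow> col t z = col t x"
          "tw s v z \<Longrightarrow> col s z = col s y" "tw t v z \<Longrightarrow> col t z = col t y" for z
          using n xy(3,4) unfolding defs by auto
      qed
    qed
  qed
  have other: "\<exists>v\<in>R. v \<noteq> u" for u using S_avoid3[of s t u] R by blast
  obtain u where u: "u \<in> R" "P u" using strip1 ex PQ other by metis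
  show False
  proof (cases "\<exists>v w. v \<in> R \<and> w \<in> R \<and> v \<noteq> u \<and> w \<noteq> u \<and> v \<noteq> w")
    case True
    \<comment> \<open>From \<open>P u\<close>, every other \<open>v\<close> in \<open>R\<close>
      satisfies \<open>Q' v\<close>. With at least two such \<open>v\<close>, \<open>P'\<close>
      fails throughout \<open>R\<close>, which contradicts \<open>strip2\<close>.\<close>
    then have "\<exists>v\<in>R. v \<noteq> u \<and> v \<noteq> w" for w by metis
    then have "\<not> P' w" if "w \<in> R" for w using PQ ex u that by metis
    then show False using strip2 ex PQ other by metis
  next
    case False
    obtain v where v: "v \<in> R" "v \<noteq> u" using other by blast
    then have "R \<subseteq> {u, v}" using False by blast
    then show False using four[of u v] u v PQ ex strip2 by blast
  qed
qed

section \<open>Vertices with a single neighbour in \<open>S\<close>\<close>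

text \<open>The strip is \<open>K s b\<close> with \<open>K t q\<close>, where \<open>b\<close> is
  the colour of all classes other than \<open>t\<close>. The W-join has \<open>c\<close> on one
  side, and a neighbour \<open>x\<close> and a non-neighbour \<open>x'\<close> of \<open>c\<close>
  on the other.\<close>

lemma tw_two_colors_aux:
  assumes c: "si s c" "E c x" "E c z" and xz: "tw s t1 x" "tw s t2 z" "col s x \<noteq> col s z"
    and d: "si t d" "t \<noteq> s" "E c d"
    and mono: "\<And>u w. \<lbrakk>tw s u w; u \<noteq> t\<rbrakk> \<Longrightarrow> col s w = col s z"
  shows False
proof -
  define b where "b = col s z"
  have st: "s \<in> S" "t \<in> S" "s \<noteq> t" using siD(1) c(1) d by blast+
  have Q_t: "tw s t y" if "tw s k y" "col s y \<noteq> b" for k y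
    using mono that unfolding b_def by blast
  have x: "tw s t x" "col s x \<noteq> b" using Q_t xz unfolding b_def by blast+
  have b_part: "\<exists>w. tw s u w \<and> col s w = b" if "u \<in> S" "u \<noteq> s" "u \<noteq> t" for u
    using tw_exists[OF st(1) that(1)] mono that unfolding b_def by blast
  have multi: "E c' w" if "si s c'" "tw s k w" "col s w = b" "tw s k' w'" "col s w' = b" "E c' w'"
    for c' k k' w w'
  proof -
    obtain u where u: "u \<in> S" "u \<noteq> s" "u \<noteq> t" "u \<noteq> k'" using S_avoid3[of s t k'] by blast
    then obtain w'' where "tw s u w''" "col s w'' = b" using b_part by blast
    then show ?thesis using tw_complete_class[of s k' w' u w'' c' k w] that u by metis
  qed
  have cK: "c \<in> K s b" using multi[OF c(1) _ _ xz(2)] c(1,3) unfolding K_def b_def by blast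
  \<comment> \<open>As \<open>c\<close> sees every \<open>b\<close>-coloured vertex, the vertex it
    misses has the other colour and so lies in class \<open>t\<close>.\<close>
  obtain x' where x': "tw s t x'" "col s x' \<noteq> b" "\<not> E c x'"
    using si_not_dominating[OF c(1)] cK[THEN K_cases] Q_t siD(1,5) c(1) tw_not_si by metis
  have cb: "E c w" if "tw s k w" "col s w = b" for k w
    using multi[OF c(1) that xz(2)] c b_def by blast
  have c_out: "m = t" if e: "si m e" "E c e" "m \<noteq> s" for m e
  proof (rule ccontr)
    assume m: "m \<noteq> t"
    obtain u where u: "u \<in> S" "u \<noteq> s" "u \<noteq> t" "u \<noteq> m" using S_avoid3[of s t m] by blast
    then obtain w where w: "tw s u w" "col s w = b" using b_part by blast
    have "\<not> E e x" "\<not> E e w"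
      using si_tw_nonadj[OF e(1) x(1)] si_tw_nonadj[OF e(1) w(1)] e u m by blast+
    moreover have "\<not> E x w" using col[OF x(1) w(1)] u w x by blast
    ultimately show False
      using no_claw[of c e x w] c e cb w x tw_not_si by metis
  qed
  have x_out: "E y e" if "tw s t y" "col s y \<noteq> b" "E c y" "si t e" "E c e" for y e
  proof (rule ccontr)
    assume n: "\<not> E y e"
    obtain u where u: "u \<in> S" "u \<noteq> s" "u \<noteq> t" using S_avoid3[of s t t] by blast
    then obtain w where w: "tw s u w" "col s w = b" using b_part by blast
    have "\<not> E e w" using si_tw_nonadj[OF that(4) w(1)] st u by blast
    moreover have "\<not> E y w" using col[OF that(1) w(1)] u w that by blast
    ultimately show False
      using no_claw[of c y e w] n cb that w tw_not_si by metis
  qed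
  define q where "q = col t x"
  have Q_part: "\<exists>w. tw t u w \<and> col t w = col t y \<and> E y w"
    if y: "tw s t y" "col s y \<noteq> b" and u: "u \<in> S" "u \<noteq> s" "u \<noteq> t" for y u
  proof -
    obtain w where w: "tw s u w \<or> tw t u w" "E y w" using tw_nbr[OF y(1) u] by blast
    have "\<not> tw s u w"
      using col[OF y(1), of u w] mono[of u w] y u w b_def by blast
    then show ?thesis using w col[OF tw_sym[OF y(1)], of u w] u by blast
  qed
  have q_part: "\<exists>w. tw t u w \<and> col t w = q" if "u \<in> S" "u \<noteq> s" "u \<noteq> t" for u
    using Q_part[OF x that] q_def by blast
  have c_tw_t: "\<not> E c w" if "tw t k w" "k \<noteq> s" for k w
    using si_tw_nonadj[OF c(1) that(1)] st that by blast
  \<comment> \<open>A second colour at \<open>t\<close> gives a claw at \<open>d\<close> with leaves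
    \<open>c\<close>, \<open>w1\<close>, \<open>w2\<close> if \<open>c\<close> sees
    \<open>y\<close>, and one at \<open>x\<close> with leaves \<open>c\<close>, \<open>y\<close>,
    \<open>w1\<close> if not.\<close>
  have Q_col: "col t y = q" if y: "tw s t y" "col s y \<noteq> b" for y
  proof (rule ccontr)
    assume n: "col t y \<noteq> q"
    obtain k1 where k1: "k1 \<in> S" "k1 \<noteq> s" "k1 \<noteq> t" using S_avoid3[of s t t] by blast
    obtain k2 where k2: "k2 \<in> S" "k2 \<noteq> s" "k2 \<noteq> t" "k2 \<noteq> k1" using S_avoid3[of s t k1] by blast
    obtain w1 where w1: "tw t k1 w1" "col t w1 = q" "E x w1"
      using Q_part[OF x k1] q_def by blast
    obtain w2 where w2: "tw t k2 w2" "col t w2 = col t y" "E y w2" using Q_part[OF y k2(1-3)] by blast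
    show False
    proof (cases "E c y")
      case True
      have "E d x" "E d y" using x_out x y True c d E_sym by blast+
      then have "E d w1" "E d w2"
        using tw_si_triple[OF tw_sym[OF x(1)] w1(1) _ w1(3) d(1)]
          tw_si_triple[OF tw_sym[OF y(1)] w2(1) _ w2(3) d(1)] k1 k2 by blast+
      moreover have "\<not> E w1 w2" using col[OF w1(1) w2(1)] w1 w2 k2 n by blast
      moreover have "\<not> E c w1" "\<not> E c w2" using c_tw_t w1 w2 k1 k2 by blast+
      ultimately show False
        using no_claw[of d c w1 w2] E_sym[OF d(3)] w1 w2 n c(1) tw_not_si by metis
    next
      case False
      have "y \<noteq> x" using n q_def by blast
      then have "E x y" using col_eq_adj[OF x(1) y(1)] x y by blast
      moreover have "\<not> E y w1" using col[OF tw_sym[OF y(1)] w1(1)] n w1 k1 by blast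
      moreover have "\<not> E c w1" using c_tw_t w1 k1 by blast
      moreover have "y \<noteq> w1" "c \<noteq> y" "c \<noteq> w1" using n w1 c(1) y(1) tw_not_si by metis+
      ultimately show False
        using no_claw[of x c y w1] E_sym[OF c(2)] w1 False by blast
    qed
  qed
  obtain k where k: "k \<in> S" "k \<noteq> s" "k \<noteq> t" using S_avoid3[of s t t] by blast
  obtain w0 where w0: "tw s k w0" "col s w0 = b" using b_part k by blast
  obtain v0 where v0: "tw t k v0" "col t v0 = q" using q_part k by blast
  \<comment> \<open>A vertex \<open>c'\<close> outside \<open>K s b\<close> misses all
    \<open>b\<close>-coloured vertices, so it reaches \<open>k\<close> through some
    \<open>z'\<close> in \<open>si k\<close>. Transitivity through \<open>d\<close> makes
    \<open>c\<close> see \<open>z'\<close>, against \<open>c_out\<close>.\<close>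
  have Cs: "c' \<in> K s b" if c': "si s c'" for c'
  proof (rule ccontr)
    assume n: "c' \<notin> K s b"
    then have anti: "\<not> E c' w" if "tw s m w" "col s w = b" for m w
      using multi[OF c' _ _ that] c' unfolding K_def by blast
    have cc': "E c c'" using si_clique[OF c(1) c'] n cK by blast
    have "E d c'"
    proof (rule ccontr)
      assume "\<not> E d c'"
      moreover have "\<not> E d w0" using si_tw_nonadj[OF d(1) w0(1)] k st by blast
      moreover have "d \<noteq> c'" using d c' siD(1,2) si_only by metis
      ultimately show False
        using no_claw[of c d c' w0] d cc' cb[OF w0] anti[OF w0] w0 c' tw_not_si by metis
    qed
    obtain z' where "tw s k z' \<or> si k z'" "E c' z'" using si_nbr[OF c' k(1,2)] by blast
    then have z': "si k z'" "E c' z'" using anti mono k unfolding b_def by blast+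
    have "E d z'"
      using outer_trans[OF c' d(1) z'(1)] \<open>E d c'\<close> z' k st E_sym by blast
    then have "E c z'"
      using outer_trans[OF d(1) c(1) z'(1)] d k st E_sym by blast
    then show False using c_out z' k by blast
  qed
  have Ct: "e \<in> K t q" if "si t e" "E e y" "tw s t y" "col s y \<noteq> b" for e y
    using tw_complete_class[OF tw_sym[OF that(3)] v0(1) _ _ that(1,2)] v0 k Q_col that
    unfolding K_def by blast
  have tw_K: "w \<in> K s b \<union> K t q" if "tw s m w" for m w
    using K_tw[OF that] K_tw[OF tw_sym] Q_t[OF that] Q_col by blast
  have c_closed: "w \<in> K s b \<union> K t q" if w: "E c w" for w
  proof (cases "w \<in> S")
    case True
    then show ?thesis using si_only[OF c(1)] w unfolding K_def by blast
  next
    case False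
    have "w \<in> V" using w E_sym E_V by blast
    then show ?thesis using False
    proof (cases rule: outside_cases)
      case (1 m)
      have "E x w" if "m = t" using x_out[OF x c(2)] 1 w that by blast
      then have "w \<in> K t q" if "m = t" using Ct[of w x] 1 that x E_sym by blast
      then show ?thesis using Cs c_out 1 w by blast
    next
      case (2 m n)
      then show ?thesis using si_tw_nonadj[OF c(1) 2] w tw_K tw_sym by blast
    qed
  qed
  have Q_closed: "w \<in> K s b \<union> K t q" if y: "tw s t y" "col s y \<noteq> b" and w: "E y w" for y w
  proof (cases "w \<in> S")
    case True
    then show ?thesis using tw_only[OF y(1)] w unfolding K_def by blast
  next
    case False
    have "w \<in> V" using w E_sym E_V by blast
    then show ?thesis using False
    proof (cases rule: outside_cases)
      case (1 m)
      then have "m = s \<or> m = t" using si_tw_nonadj[OF 1 y(1)] w by blast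
      then show ?thesis using Cs Ct[of w y] y 1 E_sym[OF w] by blast
    next
      case (2 m n)
      have "m = s \<or> m = t \<or> n = s \<or> n = t"
        using tw_disjoint_nonadj[OF y(1) 2] w by blast
      then obtain k where k: "tw s k w \<or> tw t k w" using 2 tw_sym by blast
      show ?thesis
      proof (cases "tw s k w \<or> k = s")
        case True
        then have "tw s k w \<or> tw s t w" using k tw_sym by blast
        then show ?thesis using tw_K by blast
      next
        case False
        then have k': "tw t k w" "k \<noteq> s" using k by blast+
        then have "col t w = q" using col[OF tw_sym[OF y(1)] k'(1)] w Q_col[OF y] by blast
        then show ?thesis using K_tw[OF k'(1)] by blast
      qed
    qed
  qed
  have QK: "y \<in> K t q" "y \<notin> K s b" if "tw s t y" "col s y \<noteq> b" for y
    using K_tw[OF that(1)] K_tw[OF tw_sym[OF that(1)]] Q_col that by blast+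
  have nK: "c \<notin> K t q" using si_K[OF c(1)] st by blast
  show False
    by (rule strip_W_join[OF st b_part q_part cK nK c_closed cK nK c_closed
        QK[OF x] Q_closed[OF x] QK[OF x'(1,2)] Q_closed[OF x'(1,2)] c(2) x'(3)])
qed

text \<open>With an outer neighbour \<open>d\<close> in \<open>si t\<close>, two differently
  coloured classes other than \<open>t\<close> would give a claw at \<open>c\<close>. Hence all
  classes but \<open>t\<close> share one colour, as \<open>tw_two_colors_aux\<close>
  requires.\<close>

lemma si_tw_col_eq:
  assumes c: "si s c" "E c x" "E c z" and xz: "tw s t1 x" "tw s t2 z"
  shows "col s x = col s z"
proof (rule ccontr)
  assume n: "col s x \<noteq> col s z"
  obtain t d where d: "si t d" "t \<noteq> s" "E c d" using outer_exists[OF c(1)] by blast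
  have st: "s \<in> S" "t \<in> S" using siD(1) c(1) d by blast+
  have mv: "\<exists>y''. tw s k' y'' \<and> col s y'' = col s y \<and> E c y''"
    if "tw s k y" "E c y" "tw s k' y'" "col s y' = col s y" for k k' y y'
    using that tw_si_triple[OF that(1,3)] col[OF that(1,3)] c(1) by (cases "k = k'") blast+
  have no: False if w: "tw s u1 w1" "tw s u2 w2" "u1 \<noteq> u2" "u1 \<noteq> t" "u2 \<noteq> t"
    "col s w1 = col s x" "col s w2 = col s z" for u1 u2 w1 w2
  proof -
    obtain y1 where y1: "tw s u1 y1" "col s y1 = col s x" "E c y1"
      using mv[OF xz(1) c(2) w(1,6)] by blast
    obtain y2 where y2: "tw s u2 y2" "col s y2 = col s z" "E c y2"
      using mv[OF xz(2) c(3) w(2,7)] by blast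
    have "\<not> E d y1" "\<not> E d y2"
      using si_tw_nonadj[OF d(1) y1(1)] si_tw_nonadj[OF d(1) y2(1)] d w by blast+
    moreover have "\<not> E y1 y2" using col[OF y1(1) y2(1)] y1 y2 w n by blast
    ultimately show False
      using no_claw[of c d y1 y2] d y1 y2 n tw_not_si by metis
  qed
  obtain k1 where k1: "k1 \<in> S" "k1 \<noteq> s" "k1 \<noteq> t" using S_avoid3[of s t t] by blast
  obtain w1 where w1: "tw s k1 w1" using tw_exists st k1 by metis
  obtain k2 where k2: "k2 \<in> S" "k2 \<noteq> s" "k2 \<noteq> t" "k2 \<noteq> k1" using S_avoid3[of s t k1] by blast
  obtain w2 where w2: "tw s k2 w2" using tw_exists st k2 by metis
  have cols: "col s w = col s x \<or> col s w = col s z" for w using n by blast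
  have "col s w = col s w1" if w: "tw s u w" "u \<noteq> t" for u w
  proof (rule ccontr)
    assume "col s w \<noteq> col s w1"
    moreover have "col s w2 = col s w1"
      using no[OF w1 w2] no[OF w2 w1] k1 k2 cols by metis
    ultimately show False
      using no[OF w1 w(1)] no[OF w(1) w1] no[OF w2 w(1)] no[OF w(1) w2] w k1 k2 cols by metis
  qed
  then show False
    using tw_two_colors_aux[OF c xz n d] tw_two_colors_aux[OF c(1,3,2) xz(2,1) n[symmetric] d] cols
    by metis
qed

text \<open>Only two vertices of one class need an argument. A vertex \<open>w\<close> of another
  class either transfers the adjacency or, by a claw at \<open>s\<close>, gives \<open>c\<close>
  neighbours of both colours.\<close>

lemma si_complete_class:
  assumes c: "si s c" "E c x" and xy: "tw s t x" "tw s u y" "col s x = col s y"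
  shows "E c y"
proof (rule ccontr)
  assume n: "\<not> E c y"
  have ut: "u = t" using tw_si_triple[OF xy(1,2)] col[OF xy(1,2)] xy(3) c n by blast
  obtain v where v: "v \<in> S" "v \<noteq> s" "v \<noteq> t" using S_avoid3[of s t t] by blast
  then obtain w where w: "tw s v w" using tw_exists siD(1)[OF c(1)] by metis
  show False
  proof (cases "col s w = col s x")
    case True
    then show False using tw_complete_class[OF xy(1) w _ _ c xy(2)] v xy n by metis
  next
    case False
    then have "\<not> E y w" "y \<noteq> w" using col[OF xy(2) w] v ut xy(3) by auto
    then have "E c w" using nonadj_si[OF xy(2) w _ _ c(1)] n by blast
    then show False using si_tw_col_eq[OF c(1,2) _ xy(1) w] False by metis
  qed
qed

text \<open>
  If \<open>c\<close> has no neighbour in any class \<open>tw s t\<close>, these classes carry only one colour and \<open>c\<close>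
  receives the other one.
\<close>
definition sicol :: "'a \<Rightarrow> 'a \<Rightarrow> bool" where
  "sicol s c = (if \<exists>t x. tw s t x \<and> E c x then \<exists>t x. tw s t x \<and> E c x \<and> col s x
     else \<exists>t x. tw s t x \<and> \<not> col s x)"

lemma sicol:
  assumes c: "si s c" and x: "tw s t x"
  shows "E c x \<longleftrightarrow> sicol s c = col s x"
proof (cases "\<exists>t x. tw s t x \<and> E c x")
  case True
  then obtain t0 x0 where x0: "tw s t0 x0" "E c x0" by blast
  have "sicol s c = col s x0"
    using True x0 si_tw_col_eq[OF c _ x0(2) _ x0(1)] unfolding sicol_def by metis
  then show ?thesis
    using si_tw_col_eq[OF c x0(2) _ x0(1) x] si_complete_class[OF c x0(2,1) x] by metis
next
  case False
  \<comment> \<open>Two non-adjacent vertices of different classes would form a claw at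
    \<open>s\<close> together with \<open>c\<close>.\<close>
  have ne: "col s y = col s z" if "tw s t1 y" "tw s t2 z" "t1 \<noteq> t2" for y z t1 t2
    using nonadj_si[OF that(1,2) _ _ c] col[OF that] False that by metis
  have "col s y = col s x" if y: "tw s u y" for u y
  proof (cases "u = t")
    case True
    obtain v where v: "v \<in> S" "v \<noteq> s" "v \<noteq> t" using S_avoid3[of s t t] by blast
    then obtain w where w: "tw s v w" using tw_exists siD(1)[OF c(1)] by metis
    show ?thesis using ne[OF y w] ne[OF x w] v True by metis
  next
    case False
    then show ?thesis using ne[OF y x] by blast
  qed
  then have "sicol s c \<noteq> col s x" using False x unfolding sicol_def by metis
  then show ?thesis using False x by blast
qed

section \<open>Adjacency between single-neighbour vertices at different elements of
  \<open>S\<close>\<close>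

text \<open>Since \<open>c'\<close> misses \<open>z\<close> by its colour, a claw at
  \<open>c\<close> with leaves \<open>c'\<close>, \<open>d\<close>, \<open>z\<close> must be
  avoided.\<close>

lemma outer_swap:
  assumes "si s c" "si s c'" "sicol s c \<noteq> sicol s c'" "si t d" "s \<noteq> t" "E c d"
    "tw s u z" "u \<noteq> t" "E c z"
  shows "E c' d"
proof (rule ccontr)
  assume n: "\<not> E c' d"
  have cc: "E c c'" using si_clique assms(1-3) by blast
  have "\<not> E d z" using si_tw_nonadj[OF assms(4,7)] assms by blast
  moreover have "\<not> E c' z"
    using sicol[OF assms(1,7)] sicol[OF assms(2,7)] assms by blast
  moreover have "c' \<noteq> d" using assms siD(1,2) si_only by metis
  ultimately show False
    using no_claw[of c c' d z] n cc assms tw_not_si by metis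
qed

text \<open>A neighbour in a third set \<open>si k\<close> would be carried along the whole path by
  \<open>outer_trans\<close> and then join \<open>c1\<close> to \<open>d2\<close>.\<close>

lemma outer_N_no_third:
  assumes c: "si s c1" "si s c2" and d: "si t d1" "si t d2" and st: "s \<noteq> t"
    and e: "E c1 d1" "E d1 c2" "E c2 d2" "\<not> E c1 d2" and k: "si k f" "k \<noteq> s" "k \<noteq> t"
  shows "\<not> E c1 f" "\<not> E c2 f" "\<not> E d1 f" "\<not> E d2 f"
proof -
  note T = outer_trans
  have c1: "\<not> E c1 f"
  proof
    assume 0: "E c1 f"
    then have "E d1 f" using T[OF c(1) d(1) k(1)] st k e by blast
    then have "E c2 f" using T[OF d(1) c(2) k(1)] st k e by blast
    then have "E d2 f" using T[OF c(2) d(2) k(1)] st k e by blast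
    then show False using T[OF k(1) c(1) d(2)] st k e 0 E_sym by blast
  qed
  then show "\<not> E c1 f" .
  show d1: "\<not> E d1 f" using T[OF d(1) c(1) k(1)] st k e E_sym c1 by blast
  show c2: "\<not> E c2 f" using T[OF c(2) d(1) k(1)] st k e E_sym d1 by blast
  show "\<not> E d2 f" using T[OF d(2) c(2) k(1)] st k e E_sym c2 by blast
qed

text \<open>By \<open>outer_swap\<close>, a vertex \<open>c'\<close> of the other colour would see
  both \<open>d1\<close> and \<open>d2\<close>, and swapping back would add the missing edge from
  \<open>c1\<close> to \<open>d2\<close>.\<close>

lemma outer_N_mono:
  assumes c: "si s c1" "si s c2" and d: "si t d1" "si t d2" and st: "s \<noteq> t"
    and e: "E c1 d1" "E d1 c2" "E c2 d2" "\<not> E c1 d2" and c': "si s c'"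
  shows "sicol s c' = sicol s c1"
proof (rule ccontr)
  assume n: "sicol s c' \<noteq> sicol s c1"
  note third = outer_N_no_third[OF c d st e]
  obtain k where k: "k \<in> S" "k \<noteq> s" "k \<noteq> t" using S_avoid3[of s t t] by blast
  obtain z1 where z1: "tw s k z1" "E c1 z1" using si_nbr[OF c(1) k(1,2)] third k by blast
  obtain z2 where z2: "tw s k z2" "E c2 z2" using si_nbr[OF c(2) k(1,2)] third k by blast
  have c2: "sicol s c2 = sicol s c1"
    using outer_swap[OF c(2,1) _ d(2) st e(3) z2(1) k(3) z2(2)] e by blast
  have "E c' d1" using outer_swap[OF c(1) c' _ d(1) st e(1) z1(1) k(3) z1(2)] n by blast
  then have "\<not> E c' f" if "si k f" for f
    using outer_trans[OF c' d(1) that] third(3)[OF that] k st by blast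
  then obtain z' where z': "tw s k z'" "E c' z'" using si_nbr[OF c' k(1,2)] by blast
  have "E c' d2" using outer_swap[OF c(2) c' _ d(2) st e(3) z2(1) k(3) z2(2)] n c2 by metis
  then show False using outer_swap[OF c' c(1) n d(2) st _ z'(1) k(3) z'(2)] e by blast
qed

text \<open>If the edge were missing, the path would be confined to the strip \<open>K s p\<close>
  with \<open>K t q\<close>, with \<open>c1\<close> on one side of the W-join and \<open>d1\<close>,
  \<open>d2\<close> on the other.\<close>

lemma outer_N_free:
  assumes c: "si s c1" "si s c2" and d: "si t d1" "si t d2" and st: "s \<noteq> t"
    and e: "E c1 d1" "E d1 c2" "E c2 d2"
  shows "E c1 d2"
proof (rule ccontr)
  assume n: "\<not> E c1 d2"
  note third = outer_N_no_third[OF c d st e n]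
  have e': "E d2 c2" "E c2 d1" "E d1 c1" "\<not> E d2 c1" using e n E_sym by blast+
  note st' = st[symmetric]
  have S: "s \<in> S" "t \<in> S" using siD(1) c d by blast+
  define p q where "p = sicol s c1" and "q = sicol t d2"
  have Cs: "c' \<in> K s p" if "si s c'" for c'
    using outer_N_mono[OF c d st e n that] sicol[OF that] that unfolding K_def p_def by blast
  have Ct: "d' \<in> K t q" if "si t d'" for d'
    using outer_N_mono[OF d(2,1) c(2,1) st' e' that] sicol[OF that] that
    unfolding K_def q_def by blast
  have tw_p: "w \<in> K s p" if "si s c'" "tw s m w" "E c' w" for c' m w
    using outer_N_mono[OF c d st e n that(1)] sicol[OF that(1,2)] that K_tw[OF that(2)]
    unfolding p_def by blast
  have tw_q: "w \<in> K t q" if "si t d'" "tw t m w" "E d' w" for d' m w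
    using outer_N_mono[OF d(2,1) c(2,1) st' e' that(1)] sicol[OF that(1,2)] that K_tw[OF that(2)]
    unfolding q_def by blast
  have closed: "w \<in> K s p \<union> K t q"
    if v: "si s v \<or> si t v" "\<And>k f. \<lbrakk>si k f; k \<noteq> s; k \<noteq> t\<rbrakk> \<Longrightarrow> \<not> E v f" and w: "E v w" for v w
  proof (cases "w \<in> S")
    case True
    then have "w = s \<or> w = t" using si_only v(1) w by blast
    then show ?thesis unfolding K_def by blast
  next
    case False
    have "w \<in> V" using w E_sym E_V by blast
    then show ?thesis using False
    proof (cases rule: outside_cases)
      case (1 m)
      then show ?thesis using v w Cs Ct by blast
    next
      case (2 m n)
      then have "tw m n w" "tw n m w" using tw_sym by blast+
      then show ?thesis using v(1) si_tw_nonadj[OF _ 2] w tw_p tw_q by blast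
    qed
  qed
  have p: "\<exists>x. tw s u x \<and> col s x = p" if "u \<in> S" "u \<noteq> s" "u \<noteq> t" for u
    using si_nbr[OF c(1) that(1,2)] third(1) that sicol[OF c(1)] unfolding p_def by metis
  have q: "\<exists>x. tw t u x \<and> col t x = q" if "u \<in> S" "u \<noteq> s" "u \<noteq> t" for u
    using si_nbr[OF d(2) that(1,3)] third(4) that sicol[OF d(2)] unfolding q_def by metis
  have c1cl: "w \<in> K s p \<union> K t q" if "E c1 w" for w
    using closed[of c1 w] third that c by blast
  have d1cl: "w \<in> K s p \<union> K t q" if "E d1 w" for w
    using closed[of d1 w] third that d by blast
  have d2cl: "w \<in> K s p \<union> K t q" if "E d2 w" for w
    using closed[of d2 w] third that d by blast
  have nK: "c1 \<notin> K t q" "d1 \<notin> K s p" "d2 \<notin> K s p" using si_K c d S st by blast+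
  show False
    by (rule strip_W_join[OF S st p q Cs[OF c(1)] nK(1) c1cl Cs[OF c(1)] nK(1) c1cl
        Ct[OF d(1)] nK(2) d1cl Ct[OF d(2)] nK(3) d2cl e(1) n])
qed

section \<open>The root graph\<close>

definition outer :: "'a rel" where
  "outer = {(c, d). \<exists>s t. si s c \<and> si t d \<and> s \<noteq> t \<and> E c d}"

lemma outer_sym: "sym (outer\<^sup>*)"
  by (rule sym_rtrancl) (use E_sym in \<open>auto simp: sym_def outer_def\<close>)

lemma si_unique: "\<lbrakk>si s c; si t c\<rbrakk> \<Longrightarrow> s = t"
  using siD(1,2) si_only by metis

lemma outerI: "\<lbrakk>si s c; si t d; s \<noteq> t; E c d\<rbrakk> \<Longrightarrow> (c, d) \<in> outer"
  unfolding outer_def by blast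

text \<open>Components are complete multipartite with parts in the sets \<open>si s\<close>. Along a
  path, \<open>outer_trans\<close> handles three different parts and \<open>outer_N_free\<close> an
  alternation between two.\<close>

lemma outer_component:
  assumes "(c, e) \<in> outer\<^sup>*" "si s c" "si t e"
  shows "if t = s then e = c \<or> (\<exists>u d. si u d \<and> u \<noteq> s \<and> E c d \<and> E d e) else E c e"
  using assms(1,3)
proof (induction arbitrary: t rule: rtrancl_induct)
  case base
  then show ?case using si_unique[OF _ assms(2)] by simp
next
  case (step e f)
  then obtain k where ef: "si k e" "si t f" "k \<noteq> t" "E e f"
    using si_unique unfolding outer_def by blast
  note IH = step.IH[OF ef(1)]
  show ?case
  proof (cases "k = s")
    case True
    then have ts: "t \<noteq> s" using ef(3) by blast
    consider "e = c" | u d where "si u d" "u \<noteq> s" "E c d" "E d e" using IH True by auto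
    then have "E c f"
    proof cases
      case 1
      then show ?thesis using ef by simp
    next
      case (2 u d)
      show ?thesis
      proof (cases "u = t")
        case True
        show ?thesis
          by (rule outer_N_free[of s c e t d f]) (use 2 True ef assms \<open>k = s\<close> ts in auto)
      next
        case False
        have "E d f"
          by (rule outer_trans[of s e u d t f]) (use 2 False ef \<open>k = s\<close> ts E_sym in auto)
        then show ?thesis
          using outer_trans[of u d s c t f] 2 False ef assms ts E_sym by metis
      qed
    qed
    then show ?thesis using ts by simp
  next
    case False
    then have ce: "E c e" using IH by simp
    show ?thesis
    proof (cases "t = s")
      case True
      then show ?thesis using ce ef False by auto
    next
      case ts: False
      have "E c f"
        by (rule outer_trans[of k e s c t f]) (use ce ef assms False ts E_sym in auto)
      then show ?thesis using ts by simp
    qed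
  qed
qed

text \<open>Such vertices are adjacent by \<open>si_clique\<close> but disagree at \<open>s\<close>,
  so their shared end has to be the component; \<open>outer_swap\<close> supplies a common outer
  neighbour.\<close>

lemma sicol_neq_component:
  assumes c: "si s c" "si s c'" "sicol s c \<noteq> sicol s c'"
  shows "(c, c') \<in> outer\<^sup>*"
proof -
  have via: "(c, c') \<in> outer\<^sup>*" if "si t d" "t \<noteq> s" "E c d" "E c' d" for t d
  proof -
    have "(c, d) \<in> outer" "(d, c') \<in> outer"
      using outerI[of s c t d] outerI[of t d s c'] that c E_sym by blast+
    then show ?thesis by auto
  qed
  obtain t d where d: "si t d" "t \<noteq> s" "E c d" using outer_exists[OF c(1)] by blast
  obtain t' d' where d': "si t' d'" "t' \<noteq> s" "E c' d'" using outer_exists[OF c(2)] by blast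
  have s: "s \<in> S" using siD(1) c by blast
  show ?thesis
  proof (cases "\<exists>k z. tw s k z \<and> k \<noteq> t \<and> E c z")
    case True
    then show ?thesis using outer_swap[OF c d(1) _ d(3)] d via by metis
  next
    case False
    \<comment> \<open>Since \<open>c\<close> misses the class of \<open>k\<close>, \<open>c'\<close>
      sees it; avoiding \<open>t'\<close> as well lets the swap start from
      \<open>c'\<close>.\<close>
    obtain k where k: "k \<in> S" "k \<noteq> s" "k \<noteq> t" "k \<noteq> t'" using S_avoid3[of s t t'] by blast
    obtain z where z: "tw s k z" using tw_exists s k by metis
    then have "\<not> E c z" using False k by blast
    then have "E c' z" using sicol[OF c(1) z] sicol[OF c(2) z] c(3) by blast
    then show ?thesis
      using outer_swap[OF c(2,1) c(3)[symmetric] d'(1) _ d'(3) z] d' k via by blast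
  qed
qed

text \<open>
  The end vertices of \<open>v\<close>, viewed as an edge of the root graph: \<open>S\<close> becomes a matching with edges
  \<open>{Inl (s, True), Inl (s, False)}\<close>, and the unmatched vertices are the components of \<open>outer\<close>.
\<close>
definition ends :: "'a \<Rightarrow> ('a \<times> bool + 'a set) set" where
  "ends v = {Inl (v, b) | b. v \<in> S} \<union> {Inl (s, col s v) | s. \<exists>t. tw s t v} \<union>
     (\<Union>s \<in> {s. si s v}. {Inl (s, sicol s v), Inr (outer\<^sup>* `` {v})})"

lemma ends_S: "s \<in> S \<Longrightarrow> ends s = {Inl (s, True), Inl (s, False)}"
  unfolding ends_def using twD(9) siD(5) by (auto; metis)

lemma ends_tw:
  assumes "tw s t x"
  shows "ends x = {Inl (s, col s x), Inl (t, col t x)}"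
proof -
  have "(\<exists>t. tw u t x) \<longleftrightarrow> u = s \<or> u = t" for u
    using assms tw_sym tw_only twD(1,2,4) by metis
  then show ?thesis unfolding ends_def using assms tw_not_si[OF assms] twD(9)[OF assms] by auto
qed

lemma ends_si:
  assumes "si s c"
  shows "ends c = {Inl (s, sicol s c), Inr (outer\<^sup>* `` {c})}"
proof -
  have "{s. si s c} = {s}" using assms si_unique by blast
  then show ?thesis unfolding ends_def using assms tw_not_si siD(5)[OF assms] by auto
qed

lemma V_cases:
  assumes "v \<in> V"
  obtains "v \<in> S" | s where "si s v" | s t where "tw s t v"
  using outside_cases[OF assms] by blast

lemma card_ends: "v \<in> V \<Longrightarrow> card (ends v) = 2"
  by (erule V_cases) (auto simp: ends_S ends_si ends_tw dest: twD(3))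

lemma adj_S_iff:
  assumes "s \<in> S" "v \<in> V" "v \<noteq> s"
  shows "E s v \<longleftrightarrow> ends s \<inter> ends v \<noteq> {}"
  using assms(2)
proof (cases rule: V_cases)
  case 1
  then show ?thesis using S_indep assms by (auto simp: ends_S)
next
  case (2 t)
  have "E s v \<longleftrightarrow> s = t" using siD(3)[OF 2] si_only[OF 2 assms(1)] E_sym by blast
  then show ?thesis using assms 2 by (auto simp: ends_S ends_si)
next
  case (3 t u)
  have "E s v \<longleftrightarrow> s = t \<or> s = u" using twD(6,7)[OF 3] tw_only[OF 3 assms(1)] E_sym by blast
  then show ?thesis using assms 3 by (auto simp: ends_S ends_tw)
qed

lemma adj_tw_tw_iff:
  assumes x: "tw s t x" and y: "tw u v y" and "x \<noteq> y"
  shows "E x y \<longleftrightarrow> ends x \<inter> ends y \<noteq> {}"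
proof -
  \<comment> \<open>If both neighbours in \<open>S\<close> coincide,
    \<open>tw_opposite_nonadj\<close> gives the non-adjacency; with one in common,
    \<open>col\<close> decides.\<close>
  have *: "E x y \<longleftrightarrow> col s x = col s y \<or> t = v \<and> col t x = col t y"
    if x: "tw s t x" and y: "tw s v y" for s t v
  proof (cases "t = v")
    case True
    then show ?thesis
      using tw_opposite_nonadj[OF x, of y] col_eq_adj[OF x y] col_eq_adj[OF tw_sym[OF x], of s y]
        y tw_sym \<open>x \<noteq> y\<close> by blast
  next
    case False
    then show ?thesis using col[OF x y] by blast
  qed
  consider "s = u" | "s = v" | "t = u" | "t = v" | "s \<noteq> u" "s \<noteq> v" "t \<noteq> u" "t \<noteq> v" by blast
  then show ?thesis
  proof cases
    case 1
    then show ?thesis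
      using *[of s t v] x y twD(3)[OF x] twD(3)[OF y] by (auto simp: ends_tw)
  next
    case 2
    then show ?thesis
      using *[of s t u] x tw_sym[OF y] twD(3)[OF x] twD(3)[OF y] by (auto simp: ends_tw)
  next
    case 3
    then show ?thesis
      using *[of t s v] tw_sym[OF x] y twD(3)[OF x] twD(3)[OF y] by (auto simp: ends_tw)
  next
    case 4
    then show ?thesis
      using *[of t s u] tw_sym[OF x] tw_sym[OF y] twD(3)[OF x] twD(3)[OF y]
      by (auto simp: ends_tw)
  next
    case 5
    then show ?thesis using tw_disjoint_nonadj[OF x y] by (auto simp: ends_tw[OF x] ends_tw[OF y])
  qed
qed

lemma adj_si_tw_iff:
  assumes c: "si s c" and x: "tw t u x"
  shows "E c x \<longleftrightarrow> ends c \<inter> ends x \<noteq> {}"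
proof -
  consider "s = t" | "s = u" | "s \<noteq> t" "s \<noteq> u" by blast
  then show ?thesis
  proof cases
    case 1
    then show ?thesis using sicol[OF c] x twD(3)[OF x] by (auto simp: ends_tw[OF x] ends_si[OF c])
  next
    case 2
    then show ?thesis
      using sicol[OF c] tw_sym[OF x] twD(3)[OF x] by (auto simp: ends_tw[OF x] ends_si[OF c])
  next
    case 3
    then show ?thesis using si_tw_nonadj[OF c x] by (auto simp: ends_tw[OF x] ends_si[OF c])
  qed
qed

lemma outer_image_eq_iff: "outer\<^sup>* `` {c} = outer\<^sup>* `` {d} \<longleftrightarrow> (c, d) \<in> outer\<^sup>*"
  using outer_sym by (auto simp: sym_def dest: rtrancl_trans)

lemma adj_si_si_iff:
  assumes c: "si s c" and d: "si t d" and "c \<noteq> d"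
  shows "E c d \<longleftrightarrow> ends c \<inter> ends d \<noteq> {}"
proof -
  have e: "ends c \<inter> ends d \<noteq> {} \<longleftrightarrow> s = t \<and> sicol s c = sicol t d \<or> (c, d) \<in> outer\<^sup>*"
    unfolding ends_si[OF c] ends_si[OF d] outer_image_eq_iff[symmetric] by auto
  show ?thesis
  proof (cases "s = t")
    case True
    then show ?thesis
      using si_clique[OF c, of d] sicol_neq_component[OF c, of d] d assms(3) e by blast
  next
    case False
    then show ?thesis
      using outer_component[OF _ c d] outerI[OF c d] e by auto
  qed
qed

lemma adj_iff_ends:
  assumes "u \<in> V" "v \<in> V" "u \<noteq> v"
  shows "E u v \<longleftrightarrow> ends u \<inter> ends v \<noteq> {}"
proof -
  have sym: "E u v \<longleftrightarrow> E v u" "ends u \<inter> ends v = ends v \<inter> ends u" using E_sym by auto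
  from assms(1) show ?thesis
  proof (cases rule: V_cases)
    case 1
    then show ?thesis using adj_S_iff assms by blast
  next
    case u: (2 s)
    from assms(2) show ?thesis
      by (cases rule: V_cases)
        (use u adj_S_iff[of v u] adj_si_si_iff adj_si_tw_iff assms sym in blast)+
  next
    case u: (3 s t)
    from assms(2) show ?thesis
      by (cases rule: V_cases)
        (use u adj_S_iff[of v u] adj_tw_tw_iff adj_si_tw_iff[of _ v _ _ u] assms sym in blast)+
  qed
qed

text \<open>Vertices with equal ends are adjacent and see the same other vertices, so their
  neighbourhoods would be nested.\<close>

lemma inj_on_ends: "inj_on ends V"
proof (rule inj_onI, rule ccontr)
  fix u v assume uv: "u \<in> V" "v \<in> V" "ends u = ends v" "u \<noteq> v"
  then have "E u v" using adj_iff_ends card_ends[of v] by fastforce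
  then obtain w where "E u w" "w \<noteq> v" "\<not> E v w" using not_nested by blast
  then show False using adj_iff_ends[of u w] adj_iff_ends[of v w] uv E_V E_sym E_irrefl by metis
qed

end

section \<open>Translation to the graph library\<close>

lemma pair_graphI:
  assumes "finite (pverts H)" "parcs H \<subseteq> pverts H \<times> pverts H" "sym (parcs H)" "irrefl (parcs H)"
  shows "pair_graph H"
proof
  show "finite (parcs H)" using assms(1,2) finite_subset by blast
  show "symmetric (with_proj H)" using assms(3) by (simp add: symmetric_def)
  show "fst e \<noteq> snd e" if "e \<in> parcs H" for e
    using that assms(4) by (cases e) (auto simp: irrefl_def)
  show "fst e \<in> pverts H" "snd e \<in> pverts H" if "e \<in> parcs H" for e
    using that assms(2) by auto
qed (fact assms(1))

lemma claw_freeD: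
  assumes G: "pair_graph G" and cf: "claw_free G"
    and adj: "adj G c x" "adj G c y" "adj G c z"
    and nadj: "\<not> adj G x y" "\<not> adj G x z" "\<not> adj G y z" "x \<noteq> y" "x \<noteq> z" "y \<noteq> z"
  shows False
proof -
  interpret pair_graph G by fact
  have irrefl: "\<not> adj G u u" for u using pair_no_loops[of "(u, u)"] by auto
  have sym: "adj G u v \<Longrightarrow> adj G v u" for u v using arcs_symmetric by blast
  have nadj': "\<not> adj G y x" "\<not> adj G z x" "\<not> adj G z y" using nadj sym by blast+
  have c: "c \<noteq> x" "c \<noteq> y" "c \<noteq> z" using adj irrefl by blast+
  have verts: "c \<in> pverts G" "x \<in> pverts G" "y \<in> pverts G" "z \<in> pverts G"
    using adj in_arcsD1 in_arcsD2 by blast+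
  define W where "W = {c, x, y, z}"
  have W: "W \<subseteq> pverts G" "c \<in> W" "finite W" "W - {c} = {x, y, z}"
    unfolding W_def using verts c by auto
  have iff: "adj G a b \<longleftrightarrow> (a = c) \<noteq> (b = c)" if "a \<in> W" "b \<in> W" for a b
    using that c c[symmetric] adj adj[THEN sym] nadj(1-3) nadj' irrefl unfolding W_def
    by (elim insertE emptyE) simp_all
  \<comment> \<open>The star is defined by its own arcs, which makes the bipartition evident;
    \<open>iff\<close> shows that it is induced.\<close>
  define P where "P = \<lparr> pverts = W, parcs = {c} \<times> (W - {c}) \<union> (W - {c}) \<times> {c} \<rparr>"
  have parcs: "parcs P = {e \<in> parcs G. fst e \<in> W \<and> snd e \<in> W}"
    unfolding P_def using W(2) by (auto simp: iff)
  have P: "pair_graph P"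
  proof (rule pair_graphI)
    show "finite (pverts P)" using W(3) by (simp add: P_def)
    show "parcs P \<subseteq> pverts P \<times> pverts P" using W(2) by (auto simp: P_def)
    show "sym (parcs P)" by (auto simp: P_def sym_def)
    show "irrefl (parcs P)" by (auto simp: P_def irrefl_def)
  qed
  interpret P: pair_graph P by fact
  have "induced_subgraph (with_proj P) (with_proj G)"
    unfolding induced_subgraph_def subgraph_def compatible_def
    using W(1) parcs P.wf_digraph wf_digraph by (auto simp: P_def)
  moreover have "K\<^bsub>1,3\<^esub> (with_proj P)"
    unfolding complete_bipartite_digraph_pair_def
  proof (intro conjI)
    have "card (W - {c}) = 3" unfolding W(4) using nadj by simp
    then show "\<exists>U V. pverts P = U \<union> V \<and> U \<inter> V = {} \<and> card U = 1 \<and> card V = 3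
        \<and> parcs P = U \<times> V \<union> V \<times> U"
      using W(2) by (intro exI[of _ "{c}"] exI[of _ "W - {c}"]) (auto simp: P_def)
  qed (simp add: P_def W)
  ultimately show False using cf unfolding claw_free_def by blast
qed

lemma diameter2D:
  assumes G: "pair_graph G" and d: "graph_diameter G = 2"
    and uv: "u \<in> pverts G" "v \<in> pverts G" "u \<noteq> v" "\<not> adj G u v"
  shows "\<exists>w. adj G u w \<and> adj G w v"
proof -
  interpret pair_graph G by fact
  have "\<mu> (\<lambda>_. 1) u v \<le> graph_diameter G"
    unfolding graph_diameter_def using uv by (intro SUP_upper2[of u] SUP_upper2[of v]) auto
  also have "\<dots> < 3" unfolding d by simp
  finally have "\<mu> (\<lambda>_. 1) u v < 3" .
  then obtain p where p: "awalk u p v" "ereal (awalk_cost (\<lambda>_. 1) p) < 3"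
    unfolding \<mu>_def INF_less_iff by blast
  have "awalk_cost (\<lambda>_. 1) p = real (length p)" unfolding awalk_cost_def by (induction p) auto
  then have "length p < 3" using p(2) by simp
  \<comment> \<open>A walk of unit cost below three has at most two arcs, and \<open>uv\<close>
    excludes zero and one.\<close>
  then consider "p = []" | e where "p = [e]" | e f where "p = [e, f]"
    by (cases p; cases "tl p"; cases "tl (tl p)") auto
  then show ?thesis
  proof cases
    case 1
    then show ?thesis using p uv by (simp add: awalk_Nil_iff)
  next
    case 2
    then show ?thesis using p uv by (cases e) (auto simp: awalk_Cons_iff awalk_Nil_iff)
  next
    case 3
    then show ?thesis using p uv by (cases e; cases f) (auto simp: awalk_Cons_iff awalk_Nil_iff)
  qed
qed

lemma maximum_independent_set:
  assumes "finite (pverts G)"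
  obtains S where "independent_set G S" "card S = independence_number G"
    "\<And>T. independent_set G T \<Longrightarrow> card T \<le> card S"
proof -
  let ?M = "{card S | S. independent_set G S}"
  have "?M \<subseteq> card ` Pow (pverts G)" unfolding independent_set_def by blast
  then have fin: "finite ?M" using assms finite_subset by blast
  moreover have "independent_set G {}" unfolding independent_set_def by blast
  ultimately have "Max ?M \<in> ?M" using Max_in by blast
  then show ?thesis using that Max_ge[OF fin] unfolding independence_number_def by fastforce
qed

text \<open>
  Krausz's criterion, with \<open>f v\<close> playing the role of the two cliques through \<open>v\<close>.
\<close>
lemma is_line_graphI:
  fixes G :: "'a pair_pre_digraph" and f :: "'a \<Rightarrow> 'b set"
  assumes G: "pair_graph G" and card: "\<And>v. v \<in> pverts G \<Longrightarrow> card (f v) = 2"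
    and inj: "inj_on f (pverts G)"
    and adj: "\<And>u v. \<lbrakk>u \<in> pverts G; v \<in> pverts G; u \<noteq> v\<rbrakk> \<Longrightarrow> adj G u v \<longleftrightarrow> f u \<inter> f v \<noteq> {}"
  shows "is_line_graph G"
proof -
  interpret pair_graph G by fact
  have irrefl: "\<not> adj G u u" for u using pair_no_loops[of "(u, u)"] by auto
  define U where "U = \<Union> (f ` pverts G)"
  have "finite U" unfolding U_def
    using pair_finite_verts card by (intro finite_UN_I) (auto intro: card_ge_0_finite)
  \<comment> \<open>The ends are renamed to natural numbers, the vertex type of root graphs in
    \<open>is_line_graph\<close>.\<close>
  then obtain h :: "'b \<Rightarrow> nat" where h: "inj_on h U" using finite_imp_inj_to_nat_seg[of U] by auto
  define g where "g v = h ` f v" for v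
  have fU: "f v \<subseteq> U" if "v \<in> pverts G" for v using that unfolding U_def by blast
  have g_card: "card (g v) = 2" if "v \<in> pverts G" for v
    unfolding g_def using card_image[OF inj_on_subset[OF h fU[OF that]]] card[OF that] by simp
  have g_inj: "inj_on g (pverts G)"
  proof (rule inj_onI)
    fix u v assume uv: "u \<in> pverts G" "v \<in> pverts G" "g u = g v"
    then have "f u = f v" unfolding g_def using inj_on_image_eq_iff[OF h fU fU] by blast
    then show "u = v" using inj uv inj_onD by metis
  qed
  have g_int: "g u \<inter> g v \<noteq> {} \<longleftrightarrow> f u \<inter> f v \<noteq> {}" if "u \<in> pverts G" "v \<in> pverts G" for u v
  proof -
    have "g u \<inter> g v = h ` (f u \<inter> f v)"
      unfolding g_def using inj_on_image_Int[OF h fU[OF that(1)] fU[OF that(2)]] by (rule sym)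
    then show ?thesis by simp
  qed
  define H :: "nat pair_pre_digraph" where
    "H = \<lparr> pverts = \<Union> (g ` pverts G), parcs = {(a, b). a \<noteq> b \<and> {a, b} \<in> g ` pverts G} \<rparr>"
  have fin: "finite (pverts H)"
    unfolding H_def using pair_finite_verts g_card by (simp add: card_ge_0_finite)
  have sub: "parcs H \<subseteq> pverts H \<times> pverts H" unfolding H_def by auto
  have H: "pair_graph H"
  proof (rule pair_graphI)
    have "{a, b} = {b, a}" for a b :: nat by blast
    then show "sym (parcs H)" unfolding H_def sym_def by simp
    show "irrefl (parcs H)" by (auto simp: H_def irrefl_def)
  qed (fact fin sub)+
  have edges: "edges H = g ` pverts G"
  proof -
    have e: "edges H = {e. (\<exists>a b. e = {a, b} \<and> a \<noteq> b) \<and> e \<in> g ` pverts G}"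
      unfolding edges_def H_def by auto
    have "\<exists>a b. e = {a, b} \<and> a \<noteq> b" if "e \<in> g ` pverts G" for e
      using that g_card by (auto simp: card_2_iff)
    then have "e \<in> edges H \<longleftrightarrow> e \<in> g ` pverts G" for e
      unfolding e mem_Collect_eq by iprover
    then show ?thesis by (rule set_eqI)
  qed
  define k where "k = \<lparr> iso_verts = g, iso_arcs = map_prod g g, iso_head = snd, iso_tail = fst \<rparr>"
  have arcs: "parcs (line_graph H) = map_prod g g ` parcs G"
  proof -
    have g_adj: "adj G u v \<longleftrightarrow> g u \<noteq> g v \<and> g u \<inter> g v \<noteq> {}"
      if "u \<in> pverts G" "v \<in> pverts G" for u v
      using g_int[OF that] adj[OF that] irrefl inj_onD[OF g_inj _ that] by metis
    have "parcs (line_graph H) =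
        {(g u, g v) | u v. u \<in> pverts G \<and> v \<in> pverts G \<and> g u \<noteq> g v \<and> g u \<inter> g v \<noteq> {}}"
      unfolding line_graph_def edges by auto
    also have "\<dots> = {(g u, g v) | u v. u \<in> pverts G \<and> v \<in> pverts G \<and> adj G u v}"
      using g_adj by blast
    also have "\<dots> = map_prod g g ` parcs G"
    proof -
      have "map_prod g g ` parcs G = {(g u, g v) | u v. adj G u v}" by force
      then show ?thesis using in_arcsD1 in_arcsD2 by blast
    qed
    finally show ?thesis .
  qed
  have "inj_on (map_prod g g) (parcs G)"
    by (rule inj_on_subset[OF map_prod_inj_on[OF g_inj g_inj]])
      (use in_arcsD1 in_arcsD2 in auto)
  then have "digraph_isomorphism k"
    unfolding digraph_isomorphism_def using g_inj wf_digraph by (auto simp: k_def)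
  moreover have "with_proj (line_graph H) = app_iso k (with_proj G)"
    unfolding app_iso_def with_proj_def using arcs
    by (simp add: k_def line_graph_def edges)
  ultimately show ?thesis unfolding is_line_graph_def digraph_iso_def using H by blast
qed

theorem theorem5:
  fixes G :: "'a pair_pre_digraph"
  assumes "pair_graph G"
    and "claw_free G"
    and "graph_diameter G = 2"
    and "distinct_nbhds G"
    and "\<not> (\<exists>A B. W_join G A B)"
    and "independence_number G > 3"
    and "card (pverts G) > 13"
  shows "proper_circular_arc_graph G \<or> is_line_graph G"
proof -
  interpret pair_graph G by (fact assms(1))
  obtain S where S: "independent_set G S" "card S = independence_number G"
    "\<And>T. independent_set G T \<Longrightarrow> card T \<le> card S"
    using maximum_independent_set[OF pair_finite_verts] by blast
  interpret cf: claw_free_diam2 "pverts G" "adj G" S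
  proof
    show "finite (pverts G)" by (fact pair_finite_verts)
    show sym: "adj G u v \<Longrightarrow> adj G v u" for u v using arcs_symmetric by blast
    show irrefl: "\<not> adj G v v" for v using pair_no_loops[of "(v, v)"] by auto
    show "adj G u v \<Longrightarrow> u \<in> pverts G" for u v by (rule in_arcsD1)
    show False if "adj G c x" "adj G c y" "adj G c z" "\<not> adj G x y" "\<not> adj G x z" "\<not> adj G y z"
      "x \<noteq> y" "x \<noteq> z" "y \<noteq> z" for c x y z
      using claw_freeD[OF assms(1,2) that] .
    show "\<exists>w. adj G u w \<and> adj G w v"
      if "u \<in> pverts G" "v \<in> pverts G" "u \<noteq> v" "\<not> adj G u v" for u v
      using diameter2D[OF assms(1,3) that] .
    show "\<exists>w. adj G u w \<and> w \<noteq> v \<and> \<not> adj G v w" if uv: "adj G u v" for u v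
    proof -
      have "\<not> nbhd G u - {v} \<subseteq> nbhd G v - {u}"
        using assms(4) uv in_arcsD1[OF uv] in_arcsD2[OF uv]
        unfolding distinct_nbhds_def nested_nbhds_def by blast
      then show ?thesis unfolding nbhd_def using irrefl by blast
    qed
    show "S \<subseteq> pverts G" "\<And>u v. \<lbrakk>u \<in> S; v \<in> S\<rbrakk> \<Longrightarrow> \<not> adj G u v"
      using S(1) unfolding independent_set_def by blast+
    show "card T \<le> card S" if "T \<subseteq> pverts G" "\<And>u v. \<lbrakk>u \<in> T; v \<in> T\<rbrakk> \<Longrightarrow> \<not> adj G u v" for T
      using S(3) that unfolding independent_set_def by blast
    show "4 \<le> card S" using S(2) assms(6) by simp
    fix A B a b a' b'
    assume disj: "A \<inter> B = {}"
      and A: "\<And>a a'. \<lbrakk>a \<in> A; a' \<in> A; a \<noteq> a'\<rbrakk> \<Longrightarrow> adj G a a'"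
      and B: "\<And>b b'. \<lbrakk>b \<in> B; b' \<in> B; b \<noteq> b'\<rbrakk> \<Longrightarrow> adj G b b'"
      and hA: "\<And>v. \<lbrakk>v \<in> pverts G; v \<notin> A; v \<notin> B\<rbrakk> \<Longrightarrow> (\<forall>a\<in>A. adj G v a) \<or> (\<forall>a\<in>A. \<not> adj G v a)"
      and hB: "\<And>v. \<lbrakk>v \<in> pverts G; v \<notin> A; v \<notin> B\<rbrakk> \<Longrightarrow> (\<forall>b\<in>B. adj G v b) \<or> (\<forall>b\<in>B. \<not> adj G v b)"
      and sub: "A \<subseteq> pverts G" "B \<subseteq> pverts G"
      and ab: "a \<in> A" "b \<in> B" "adj G a b" and ab': "a' \<in> A" "b' \<in> B" "\<not> adj G a' b'"
    have fin: "finite A" "finite B" using sub pair_finite_verts finite_subset by blast+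
    have "card {a, a'} \<le> card A" "card {b, b'} \<le> card B"
      using ab ab' fin by (auto intro!: card_mono)
    \<comment> \<open>An edge and a non-edge cannot be the same pair, so one of the sides has two
      elements.\<close>
    moreover have "a \<noteq> a' \<or> b \<noteq> b'" using ab ab' by blast
    ultimately have "card A + card B > 2"
      by (cases "a = a'"; cases "b = b'") auto
    moreover have "clique G A" "clique G B"
      using A B sub unfolding clique_def by blast+
    moreover have "\<not> complete_to G A B" "\<not> anticomplete_to G A B"
      using ab ab' unfolding complete_to_def anticomplete_to_def by blast+
    moreover have "(complete_to G {v} A \<or> anticomplete_to G {v} A) \<and>
        (complete_to G {v} B \<or> anticomplete_to G {v} B)" if "v \<in> pverts G - (A \<union> B)" for v
      using hA[of v] hB[of v] that unfolding complete_to_def anticomplete_to_def by auto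
    moreover have "A \<noteq> {}" "B \<noteq> {}" using ab by blast+
    ultimately have "W_join G A B" unfolding W_join_def using disj sub by simp
    then show False using assms(5) by blast
  qed
  show ?thesis
    using is_line_graphI[OF assms(1) cf.card_ends cf.inj_on_ends cf.adj_iff_ends] by blast
qed

end
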